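(* Let $1\le d<D$ be integers, let $\mathcal{X}\subseteq\mathbb{R}^D$ have non-empty interior, and let $f:\mathcal{X}\to\mathbb{R}$ be Lipschitz continuous with constant $L>0$, i.e. $|f(x)-f(y)|\le L\|x-y\|_2$ for all $x,y\in\mathcal{X}$. Let $A$ be a $D\times d$ Gaussian matrix, $\epsilon>0$, and let $x^*$ be a global minimizer of $f$ over $\mathcal{X}$ such that $B_{\epsilon/L}(x^* )\subset\mathcal{X}$. Let $R_{\max}$ be a constant with $R_{\max}>\epsilon/L$ and let $r_{\min}:=\epsilon/(LR_{\max})$. Then for all $p\in\mathcal{X}$ satisfying $\|p-x^*\|<R_{\max}$, $$\mathbb{P}[(\mathrm{RP}\mathcal{X})\ \text{is}\ \epsilon\text{-successful}]\ \ge\ \tau(r_{\min},d,D).$$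
   Context: Setting: $f^*:=\min_{x\in\mathcal{X}}f(x)$ (attained), where $\mathcal{X}\subseteq\mathbb{R}^D$ may be unbounded. $B_r(x)$ is the closed Euclidean ball of radius $r$ centred at $x$; $\|\cdot\|$ is the Euclidean norm. A Gaussian matrix is a random matrix whose entries are independent standard normal variables. For given $p\in\mathcal{X}$, the reduced problem $(\mathrm{RP}\mathcal{X})$ is $\min_{y\in\mathbb{R}^d} f(Ay+p)$ subject to $Ay+p\in\mathcal{X}$; it is called $\epsilon$-successful if there exists $y\in\mathbb{R}^d$ with $Ay+p\in\mathcal{X}$ and $f(Ay+p)\le f^*+\epsilon$. For $0<r<1$ and integers $1\le d<D$, $$\tau(r,d,D):=\begin{cases}(D-1)\binom{\frac{D-2}{2}}{\frac{D-1}{2}}\displaystyle\int_0^{\arcsin(r)}\sin^{D-2}(x)\,dx & \text{if } d=1,\\[2mm] \binom{\frac{D-2}{2}}{\frac{D-d}{2}}\,r^{D-d}(1-r^2)^{\frac{d-2}{2}} & \text{if } 1<d<D,\end{cases}$$ where $\binom{i}{j}=\frac{\Gamma(i+1)}{\Gamma(j+1)\Gamma(i-j+1)}$ for real $i,j$. *)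

theory Defs
  imports "HOL-Probability.Probability"
begin

text \<open>Generalised binomial coefficient for real upper and lower index. It is only ever used at
  arguments where none of the three Gamma values is at a pole.\<close>

definition real_binomial :: "real \<Rightarrow> real \<Rightarrow> real" where
  "real_binomial i j = Gamma (i + 1) / (Gamma (j + 1) * Gamma (i - j + 1))"

definition tau :: "real \<Rightarrow> nat \<Rightarrow> nat \<Rightarrow> real" where
  "tau r d D =
     (if d = 1 then
        (real D - 1) * real_binomial ((real D - 2) / 2) ((real D - 1) / 2)
          * integral {0..arcsin r} (\<lambda>x. sin x ^ (D - 2))
      else
        real_binomial ((real D - 2) / 2) ((real D - real d) / 2)
          * r ^ (D - d) * (1 - r\<^sup>2) powr ((real d - 2) / 2))"

text \<open>An element of \<open>real ^ 'd ^ 'D\<close> is a matrix with \<open>CARD('D)\<close> rows and \<open>CARD('d)\<close> columns;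
  \<open>A \<omega> $ i $ j\<close> is the entry in row \<open>i\<close> and column \<open>j\<close>.\<close>

definition gaussian_matrix :: "'w measure \<Rightarrow> ('w \<Rightarrow> real ^ 'd ^ 'D) \<Rightarrow> bool" where
  "gaussian_matrix M A \<longleftrightarrow>
     prob_space.indep_vars M (\<lambda>_. borel) (\<lambda>(i, j) \<omega>. A \<omega> $ i $ j) UNIV \<and>
     (\<forall>i j. distributed M lborel (\<lambda>\<omega>. A \<omega> $ i $ j) std_normal_density)"

text \<open>The minimal value of \<open>f\<close> on \<open>X\<close> is written as an infimum; it is only used when it is
  attained.\<close>

definition eps_successful ::
  "(real ^ 'D \<Rightarrow> real) \<Rightarrow> (real ^ 'D) set \<Rightarrow> real \<Rightarrow> real ^ 'D \<Rightarrow> real ^ 'd ^ 'D \<Rightarrow> bool" where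
  "eps_successful f X \<epsilon> p A \<longleftrightarrow>
     (\<exists>y :: real ^ 'd. A *v y + p \<in> X \<and> f (A *v y + p) \<le> (INF x\<in>X. f x) + \<epsilon>)"

text \<open>For an arbitrary constraint set the success event need not be measurable, whereas
  \<open>measure M\<close> returns the junk value 0 on non-measurable sets. Lower bounds on probabilities are
  therefore stated for the inner probability, which is the probability itself on every
  event of \<open>M\<close>.\<close>

definition inner_prob :: "'w measure \<Rightarrow> 'w set \<Rightarrow> real" where
  "inner_prob M S = (SUP E\<in>{E \<in> sets M. E \<subseteq> S}. measure M E)"

lemma inner_prob_eq_measure:
  assumes "prob_space M" "S \<in> sets M"
  shows "inner_prob M S = measure M S"
proof -
  interpret prob_space M by fact
  show ?thesis
    unfolding inner_prob_def
    by (rule cSup_eq_maximum) (use assms in \<open>auto intro: finite_measure_mono\<close>)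
qed

end

theory Submission
  imports Defs
begin

text \<open>Let \<open>v = x\<^sup>* - p\<close> and \<open>u = v / \<parallel>v\<parallel>\<close>. If the range of \<open>A\<close> comes within distance \<open>r\<^sub>m\<^sub>i\<^sub>n\<close> of \<open>u\<close>,
  then after scaling some \<open>A y + p\<close> lies in the ball of radius \<open>\<epsilon> / L\<close> around \<open>x\<^sup>*\<close>, so the reduced
  problem is \<open>\<epsilon>\<close>-successful. The law of \<open>A\<close> is invariant under rotations of the ambient space, so
  the probability of this event is the same for all unit vectors \<open>u\<close> and may be averaged over the
  unit ball. After exchanging the integrals it remains to bound, for one fixed \<open>d\<close>-dimensional
  subspace, the relative volume of a cone around it in the unit ball. Splitting the coordinates into
  \<open>k = D - d\<close> and \<open>d\<close> of them and using polar coordinates in both parts turns this volume into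
  \<open>\<omega>\<^sub>k \<omega>\<^sub>d k d / D\<close> times \<open>\<integral>\<^sub>0\<^sup>r s\<^sup>k\<^sup>-\<^sup>1 (1 - s\<^sup>2)\<^sup>d\<^sup>/\<^sup>2\<^sup>-\<^sup>1 ds\<close>, which equals the bound
  for \<open>d = 1\<close> and dominates it for \<open>d \<ge> 2\<close>.\<close>

subsection \<open>Lebesgue measure, rotations and rank\<close>

lemma nn_integral_lborel_translate:
  fixes h :: "'a::euclidean_space \<Rightarrow> ennreal"
  assumes [measurable]: "h \<in> borel_measurable borel"
  shows "(\<integral>\<^sup>+x. h (c + x) \<partial>lborel) = (\<integral>\<^sup>+x. h x \<partial>lborel)"
proof -
  have "(\<integral>\<^sup>+x. h x \<partial>lborel) = (\<integral>\<^sup>+x. h x \<partial>distr lborel borel ((+) c))"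
    by (simp add: lborel_distr_plus)
  then show ?thesis
    by (simp add: nn_integral_distr)
qed

text \<open>Uniqueness of Haar measure: integrating \<open>1\<^sub>B(x) 1\<^sub>S(x + f y)\<close> over \<open>x\<close> and \<open>y\<close> in
  either order, where \<open>B\<close> is the unit ball, gives \<open>vol B * vol (f -` S) = vol S * vol B\<close>.\<close>

lemma lborel_distr_orthogonal_transformation:
  fixes f :: "'a::euclidean_space \<Rightarrow> 'a"
  assumes f: "orthogonal_transformation f"
  shows "distr lborel borel f = lborel"
proof (rule measure_eqI)
  fix S assume "S \<in> sets (distr lborel borel f)"
  then have S[measurable]: "S \<in> sets borel" by simp
  define B where "B = cball (0::'a) 1"
  have B[measurable]: "B \<in> sets borel" by (simp add: B_def)
  have vB: "emeasure lborel B \<noteq> 0" "emeasure lborel B \<noteq> \<infinity>"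
    using unit_ball_vol_pos[of "DIM('a)"] by (auto simp: B_def emeasure_cball simp del: unit_ball_vol_pos)
  have lin: "linear f" using f orthogonal_transformation_linear by blast
  have fm[measurable]: "f \<in> borel_measurable borel"
    using lin by (intro borel_measurable_continuous_onI linear_continuous_on linear_conv_bounded_linear[THEN iffD1])
  have surj: "surj f" using f orthogonal_transformation_surj by blast
  \<comment> \<open>By surjectivity \<open>a = f b\<close>, so a shift outside \<open>f\<close>
    becomes a shift of its argument: the image measure is translation invariant too.\<close>
  have shift: "(\<integral>\<^sup>+y. h (a + f y) \<partial>lborel) = (\<integral>\<^sup>+y. h (f y) \<partial>lborel)"
    if [measurable]: "h \<in> borel_measurable borel" for a and h :: "'a \<Rightarrow> ennreal"
  proof -
    obtain b where "a = f b" using surj by blast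
    then have "a + f y = f (b + y)" for y using lin by (simp add: linear_add)
    then show ?thesis
      using nn_integral_lborel_translate[of "\<lambda>y. h (f y)" b] by simp
  qed
  have fB: "f -` B = B"
    using f by (auto simp: B_def orthogonal_transformation_norm)
  have iB: "(indicator B (f y) :: ennreal) = indicator B y" for y
    using fB by (auto simp: indicator_def)
  let ?I = "\<integral>\<^sup>+x. \<integral>\<^sup>+y. indicator B x * indicator S (x + f y) \<partial>lborel \<partial>lborel"
  have "?I = (\<integral>\<^sup>+x. indicator B x * (\<integral>\<^sup>+y. indicator S (f y) \<partial>lborel) \<partial>lborel)"
    using shift[of "indicator S"] by (simp add: nn_integral_cmult)
  also have "\<dots> = emeasure lborel B * (\<integral>\<^sup>+y. indicator S (f y) \<partial>lborel)"
    by (simp add: nn_integral_multc)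
  also have "(\<integral>\<^sup>+y. indicator S (f y) \<partial>lborel) = emeasure (distr lborel borel f) S"
    using nn_integral_distr[of f lborel borel "indicator S"] by simp
  finally have 1: "?I = emeasure lborel B * emeasure (distr lborel borel f) S" .
  have "?I = (\<integral>\<^sup>+y. \<integral>\<^sup>+x. indicator B x * indicator S (x + f y) \<partial>lborel \<partial>lborel)"
    by (rule lborel_pair.Fubini'[symmetric]) measurable
  also have "\<dots> = (\<integral>\<^sup>+y. \<integral>\<^sup>+x. indicator B (- f y + x) * indicator S x \<partial>lborel \<partial>lborel)"
  proof (rule nn_integral_cong)
    fix y
    show "(\<integral>\<^sup>+x. indicator B x * indicator S (x + f y) \<partial>lborel) =
          (\<integral>\<^sup>+x. indicator B (- f y + x) * (indicator S x :: ennreal) \<partial>lborel)"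
      using nn_integral_lborel_translate[of "\<lambda>x. indicator B x * indicator S (x + f y)" "- f y"]
      by simp
  qed
  also have "\<dots> = (\<integral>\<^sup>+x. \<integral>\<^sup>+y. indicator B (- f y + x) * indicator S x \<partial>lborel \<partial>lborel)"
    by (rule lborel_pair.Fubini') measurable
  \<comment> \<open>The ball is symmetric about the origin, so the argument may change sign. This
    brings the inner integral into the form that \<open>shift\<close> evaluates.\<close>
  also have "\<dots> = (\<integral>\<^sup>+x. (\<integral>\<^sup>+y. indicator B (- x + f y) \<partial>lborel) * indicator S x \<partial>lborel)"
    by (auto intro!: nn_integral_cong simp: nn_integral_multc[symmetric] B_def indicator_def norm_minus_commute)
  also have "\<dots> = emeasure lborel B * emeasure lborel S"
  proof -
    have inner: "(\<integral>\<^sup>+y. indicator B (- x + f y) \<partial>lborel) = emeasure lborel B" for x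
      using shift[of "indicator B" "- x"] by (simp add: iB)
    then show ?thesis by (subst inner) (simp add: nn_integral_cmult)
  qed
  finally have "emeasure lborel B * emeasure (distr lborel borel f) S = emeasure lborel B * emeasure lborel S"
    unfolding 1 .
  then show "emeasure (distr lborel borel f) S = emeasure lborel S"
    using vB by (simp add: ennreal_mult_cancel_left)
qed simp

section \<open>Matrices of full rank\<close>

text \<open>By the Leibniz formula the determinant is a polynomial in \<open>t\<close>. It does not
  vanish identically, because a shift beyond the operator norm of \<open>M\<close> makes the matrix
  injective.\<close>

lemma finite_det_add_scaleR_mat_roots:
  fixes M :: "real^'n^'n"
  shows "finite {t. det (M + t *\<^sub>R mat 1) = 0}"
proof -
  define P where "P = (\<Sum>p | p permutes (UNIV :: 'n set). smult (of_int (sign p))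
     (\<Prod>i\<in>UNIV. [:M $ i $ p i, if i = p i then 1 else 0:]))"
  have P: "det (M + t *\<^sub>R mat 1) = poly P t" for t
    unfolding det_def P_def poly_sum
    by (intro sum.cong refl) (auto simp: poly_prod mat_def intro!: prod.cong)
  \<comment> \<open>Any value above the operator norm serves: \<open>M *v x\<close> is then too
    short to cancel \<open>t *\<^sub>R x\<close>.\<close>
  define t where "t = onorm ((*v) M) + 1"
  have "M *v x + t *\<^sub>R x \<noteq> 0" if "x \<noteq> 0" for x
  proof
    assume "M *v x + t *\<^sub>R x = 0"
    then have "t *\<^sub>R x = - (M *v x)" by (simp add: eq_neg_iff_add_eq_0 add.commute)
    then have "norm (t *\<^sub>R x) = norm (M *v x)" by simp
    also have "\<dots> \<le> onorm ((*v) M) * norm x"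
      by (simp add: onorm)
    also have "\<dots> < t * norm x" using that by (simp add: t_def)
    also have "\<dots> \<le> norm (t *\<^sub>R x)" by (simp add: mult_right_mono)
    finally show False by simp
  qed
  moreover have "(M + t *\<^sub>R mat 1) *v x = M *v x + t *\<^sub>R x" for x
    by (simp add: matrix_vector_mult_add_rdistrib scaleR_matrix_vector_assoc[symmetric])
  ultimately have "invertible (M + t *\<^sub>R mat 1)"
    unfolding invertible_left_inverse matrix_left_invertible_ker by metis
  then have "poly P t \<noteq> 0" by (simp add: invertible_det_nz P)
  then have "P \<noteq> 0" by auto
  then show ?thesis unfolding P by (rule poly_roots_finite)
qed

text \<open>Along each line \<open>t \<mapsto> X + t E\<close>, where \<open>E\<close> embeds the \<open>d\<close> coordinates into the \<open>D\<close> ones, a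
  maximal minor is a nonzero polynomial in \<open>t\<close>.\<close>

lemma AE_lborel_inj_matrix:
  assumes "CARD('d::finite) \<le> CARD('D::finite)"
  shows "AE X in lborel :: (real^'d^'D) measure. inj ((*v) X)"
proof -
  obtain e :: "'d \<Rightarrow> 'D" where e: "inj e"
    using assms card_le_inj[of "UNIV::'d set" "UNIV::'D set"] by auto
  define sel :: "real^'d^'D \<Rightarrow> real^'d^'d" where "sel X = (\<chi> i. X $ e i)" for X
  define E :: "real^'d^'D" where "E = (\<chi> i j. if i = e j then 1 else 0)"
  define N where "N = {X. det (sel X) = 0}"
  \<comment> \<open>The rows selected from \<open>E\<close> form the identity matrix, so moving
    along \<open>E\<close> shifts the chosen minor exactly as the preceding lemma requires.\<close>
  have sel_shift: "sel (t *\<^sub>R E + X) = sel X + t *\<^sub>R mat 1" for t X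
    using e by (auto simp: sel_def E_def mat_def vec_eq_iff inj_eq)
  have "continuous_on UNIV (\<lambda>X. det (sel X))"
    unfolding det_def sel_def by (intro continuous_intros)
  then have "closed N"
    unfolding N_def by (intro closed_Collect_eq) auto
  then have N[measurable]: "N \<in> sets borel" by auto
  \<comment> \<open>The interval has length 1, so the measure of \<open>N\<close> is an average over
    translates of \<open>N\<close>. After Fubini each inner integral runs over a finite set of
    \<open>t\<close> and vanishes.\<close>
  have "emeasure lborel N = (\<integral>\<^sup>+t. indicator {0..1::real} t * emeasure lborel N \<partial>lborel)"
    by (subst nn_integral_multc) auto
  also have "\<dots> = (\<integral>\<^sup>+t. \<integral>\<^sup>+X. indicator {0..1::real} t * indicator N (t *\<^sub>R E + X) \<partial>lborel \<partial>lborel)"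
    using nn_integral_lborel_translate[of "indicator N"]
    by (simp add: nn_integral_cmult)
  also have "\<dots> = (\<integral>\<^sup>+X. \<integral>\<^sup>+t. indicator {0..1::real} t * indicator N (t *\<^sub>R E + X) \<partial>lborel \<partial>lborel)"
    by (rule lborel_pair.Fubini'[symmetric]) measurable
  also have "\<dots> \<le> (\<integral>\<^sup>+X. 0 \<partial>(lborel :: (real^'d^'D) measure))"
  proof (rule nn_integral_mono)
    fix X
    have "(\<integral>\<^sup>+t. indicator {0..1::real} t * indicator N (t *\<^sub>R E + X) \<partial>lborel)
        \<le> (\<integral>\<^sup>+t. indicator {t. det (sel X + t *\<^sub>R mat 1) = 0} t \<partial>lborel)"
      by (intro nn_integral_mono) (auto simp: N_def sel_shift indicator_def)
    also have "\<dots> = emeasure lborel {t. det (sel X + t *\<^sub>R mat 1) = 0}"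
      using finite_det_add_scaleR_mat_roots[of "sel X"]
      by (intro nn_integral_indicator) (simp add: finite_imp_closed borel_closed)
    also have "\<dots> = 0"
      using finite_det_add_scaleR_mat_roots[of "sel X"] by (rule emeasure_lborel_countable[OF countable_finite])
    finally show "(\<integral>\<^sup>+t. indicator {0..1::real} t * indicator N (t *\<^sub>R E + X) \<partial>lborel) \<le> 0" .
  qed
  finally have "N \<in> null_sets lborel" by (auto intro: null_setsI)
  moreover have "inj ((*v) X)" if "X \<notin> N" for X
  proof -
    from that have "invertible (sel X)" by (simp add: N_def invertible_det_nz)
    then have ker: "sel X *v x = 0 \<Longrightarrow> x = 0" for x
      unfolding invertible_left_inverse matrix_left_invertible_ker by blast
    have "x = 0" if "X *v x = 0" for x
    proof (rule ker)
      show "sel X *v x = 0"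
        using that by (auto simp: sel_def vec_eq_iff matrix_vector_mult_def)
    qed
    then show ?thesis
      by (auto simp: linear_injective_0)
  qed
  ultimately show ?thesis
    by (intro AE_I'[of N]) auto
qed

subsection \<open>Volumes of cones around subspaces\<close>

text \<open>The library volume formula covers positive radii. Radius 0 follows by letting the radius
  shrink, and it is needed later for shells whose inner radius is 0.\<close>

lemma emeasure_PiM_cball:
  assumes A: "finite A" "A \<noteq> {}" and r: "r \<ge> 0"
  shows "emeasure (Pi\<^sub>M A (\<lambda>_. lborel))
           {f \<in> space (Pi\<^sub>M A (\<lambda>_. lborel)). sqrt (\<Sum>i\<in>A. (f i)\<^sup>2) \<le> r} =
         ennreal (unit_ball_vol (real (card A)) * r ^ card A)"
proof -
  let ?M = "Pi\<^sub>M A (\<lambda>_. lborel :: real measure)"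
  let ?B = "\<lambda>r. {f \<in> space ?M. sqrt (\<Sum>i\<in>A. (f i)\<^sup>2) \<le> r}"
  have pos: "emeasure ?M (?B r) = ennreal (unit_ball_vol (real (card A)) * r ^ card A)"
    if "r > 0" for r
    using emeasure_cball_aux[OF A(1) that] by (simp add: Int_def conj_commute)
  show ?thesis
  proof (cases "r = 0")
    case True
    let ?g = "\<lambda>\<delta>. ennreal (unit_ball_vol (real (card A)) * \<delta> ^ card A)"
    have "((\<lambda>\<delta>. unit_ball_vol (real (card A)) * \<delta> ^ card A) \<longlongrightarrow>
           unit_ball_vol (real (card A)) * 0 ^ card A) (at_right (0::real))"
      by (intro tendsto_intros)
    from tendsto_ennrealI[OF this] have "(?g \<longlongrightarrow> 0) (at_right 0)"
      using A by (simp add: power_0_left)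
    moreover have "\<forall>\<^sub>F \<delta> in at_right 0. emeasure ?M (?B 0) \<le> ?g \<delta>"
      using eventually_at_right_less[of "0::real"]
    proof eventually_elim
      case (elim \<delta>)
      have "emeasure ?M (?B 0) \<le> emeasure ?M (?B \<delta>)"
        using elim A(1) by (intro emeasure_mono) (auto intro: order_trans[of _ 0], measurable)
      then show ?case using pos[OF elim] by simp
    qed
    ultimately have "emeasure ?M (?B 0) \<le> 0"
      by (rule tendsto_lowerbound) auto
    then show ?thesis using True A by (simp add: power_0_left)
  next
    case False
    then show ?thesis using pos r by simp
  qed
qed

text \<open>This is the radial part of polar coordinates. The density on the right is the derivative
  of the ball volume, so both measures agree on all half-lines, which generate the Borel
  sets.\<close>

lemma distr_PiM_norm:
  assumes A: "finite A" "A \<noteq> {}"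
  shows "distr (Pi\<^sub>M A (\<lambda>_. lborel)) borel (\<lambda>f. sqrt (\<Sum>i\<in>A. (f i)\<^sup>2)) =
    density lborel (\<lambda>s. ennreal (unit_ball_vol (card A) * (card A * s ^ (card A - 1))) * indicator {0..} s)"
    (is "?D = density lborel ?g")
proof (rule measure_eqI_generator_eq)
  let ?E = "range (\<lambda>a::real. {..a})"
  define \<omega> where "\<omega> = unit_ball_vol (card A)"
  have \<omega>: "\<omega> \<ge> 0" by (simp add: \<omega>_def)
  have [measurable]: "(\<lambda>f. sqrt (\<Sum>i\<in>A. (f i)\<^sup>2)) \<in> borel_measurable (Pi\<^sub>M A (\<lambda>_. lborel))"
    using A by measurable
  show "Int_stable ?E"
    by (auto simp: Int_stable_def)
  show "?E \<subseteq> Pow UNIV" by auto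
  show "sets ?D = sigma_sets UNIV ?E" "sets (density lborel ?g) = sigma_sets UNIV ?E"
    by (simp_all add: borel_eq_atMost)
  have D: "emeasure ?D {..a} = (if a \<ge> 0 then ennreal (\<omega> * a ^ card A) else 0)" for a
  proof -
    have "emeasure ?D {..a} = emeasure (Pi\<^sub>M A (\<lambda>_. lborel))
       {f \<in> space (Pi\<^sub>M A (\<lambda>_. lborel)). sqrt (\<Sum>i\<in>A. (f i)\<^sup>2) \<le> a}"
      by (subst emeasure_distr) (auto intro!: arg_cong[where f="emeasure _"])
    also have "\<dots> = (if a \<ge> 0 then ennreal (\<omega> * a ^ card A) else 0)"
    proof (cases "a \<ge> 0")
      case False
      have "sqrt (\<Sum>i\<in>A. (f i)\<^sup>2) \<ge> 0" for f :: "'a \<Rightarrow> real"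
        by (simp add: sum_nonneg)
      then have none: "\<not> sqrt (\<Sum>i\<in>A. (f i)\<^sup>2) \<le> a" for f :: "'a \<Rightarrow> real"
        using False by (meson order_trans)
      show ?thesis using False by (simp only: none) simp
    qed (simp add: emeasure_PiM_cball[OF A] \<omega>_def)
    finally show ?thesis .
  qed
  fix S assume "S \<in> ?E"
  then obtain a where S: "S = {..a}" by auto
  have "emeasure (density lborel ?g) {..a} = (if a \<ge> 0 then ennreal (\<omega> * a ^ card A) else 0)"
  proof -
    have "emeasure (density lborel ?g) {..a} =
       (\<integral>\<^sup>+s. ennreal (\<omega> * (card A * s ^ (card A - 1))) * indicator {0..a} s \<partial>lborel)"
      by (subst emeasure_density) (auto intro!: nn_integral_cong simp: \<omega>_def indicator_def)
    also have "\<dots> = (if a \<ge> 0 then ennreal (\<omega> * a ^ card A) else 0)"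
    proof (cases "a \<ge> 0")
      case True
      have "(\<integral>\<^sup>+s. ennreal (\<omega> * (card A * s ^ (card A - 1))) * indicator {0..a} s \<partial>lborel) =
          ennreal (\<omega> * a ^ card A - \<omega> * 0 ^ card A)"
        using True \<omega>
        by (intro nn_integral_FTC_Icc) (auto intro!: derivative_eq_intros)
      then show ?thesis using True A by (simp add: power_0_left)
    qed simp
    finally show ?thesis .
  qed
  then show "emeasure ?D S = emeasure (density lborel ?g) S"
    using D S by simp
next
  show "range (\<lambda>n. {..real n}) \<subseteq> range (\<lambda>a::real. {..a})" by auto
  show "(\<Union>n. {..real n}) = UNIV" by (auto simp: real_arch_simple)
  fix n :: nat
  show "emeasure ?D {..real n} \<noteq> \<infinity>"
  proof -
    have "emeasure ?D {..real n} = emeasure (Pi\<^sub>M A (\<lambda>_. lborel))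
       {f \<in> space (Pi\<^sub>M A (\<lambda>_. lborel)). sqrt (\<Sum>i\<in>A. (f i)\<^sup>2) \<le> real n}"
      using A by (subst emeasure_distr) (auto intro!: arg_cong[where f="emeasure _"], measurable)
    then show ?thesis by (simp add: emeasure_PiM_cball[OF A])
  qed
qed

lemma nn_integral_PiM_radial:
  assumes A: "finite A" "A \<noteq> {}" and [measurable]: "h \<in> borel_measurable borel"
  shows "(\<integral>\<^sup>+f. h (sqrt (\<Sum>i\<in>A. (f i)\<^sup>2)) \<partial>Pi\<^sub>M A (\<lambda>_. lborel)) =
    (\<integral>\<^sup>+s. ennreal (unit_ball_vol (card A) * (card A * s ^ (card A - 1))) * indicator {0..} s * h s \<partial>lborel)"
proof -
  have [measurable]: "(\<lambda>f. sqrt (\<Sum>i\<in>A. (f i)\<^sup>2)) \<in> borel_measurable (Pi\<^sub>M A (\<lambda>_. lborel))"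
    using A by measurable
  have "(\<integral>\<^sup>+f. h (sqrt (\<Sum>i\<in>A. (f i)\<^sup>2)) \<partial>Pi\<^sub>M A (\<lambda>_. lborel)) =
    (\<integral>\<^sup>+s. h s \<partial>distr (Pi\<^sub>M A (\<lambda>_. lborel)) borel (\<lambda>f. sqrt (\<Sum>i\<in>A. (f i)\<^sup>2)))"
    by (simp add: nn_integral_distr)
  also have "\<dots> = (\<integral>\<^sup>+s. ennreal (unit_ball_vol (card A) * (card A * s ^ (card A - 1))) * indicator {0..} s * h s \<partial>lborel)"
    unfolding distr_PiM_norm[OF A] by (subst nn_integral_density) auto
  finally show ?thesis .
qed

text \<open>For a point at distance \<open>s\<close> from the axis of the cone, the component along the axis has norm
  between \<open>s \<surd>(1 - r\<^sup>2) / r\<close> (cone) and \<open>\<surd>(1 - s\<^sup>2)\<close> (ball).\<close>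

definition cone_profile :: "real \<Rightarrow> nat \<Rightarrow> nat \<Rightarrow> real \<Rightarrow> real" where
  "cone_profile r k d s = real k * s ^ (k - 1) * (sqrt (1 - s\<^sup>2) ^ d - (s * sqrt (1 - r\<^sup>2) / r) ^ d)"

lemma emeasure_PiM_shell:
  assumes "finite A" "A \<noteq> {}" "0 \<le> a" "a \<le> b"
  shows "emeasure (Pi\<^sub>M A (\<lambda>_. lborel)) {f \<in> space (Pi\<^sub>M A (\<lambda>_. lborel)).
           a < sqrt (\<Sum>i\<in>A. (f i)\<^sup>2) \<and> sqrt (\<Sum>i\<in>A. (f i)\<^sup>2) \<le> b} =
         ennreal (unit_ball_vol (real (card A)) * (b ^ card A - a ^ card A))"
proof -
  let ?M = "Pi\<^sub>M A (\<lambda>_. lborel :: real measure)"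
  let ?B = "\<lambda>r. {f \<in> space ?M. sqrt (\<Sum>i\<in>A. (f i)\<^sup>2) \<le> r}"
  have m: "?B c \<in> sets ?M" for c using assms(1) by measurable
  have "{f \<in> space ?M. a < sqrt (\<Sum>i\<in>A. (f i)\<^sup>2) \<and> sqrt (\<Sum>i\<in>A. (f i)\<^sup>2) \<le> b} = ?B b - ?B a"
    by auto
  also have "emeasure ?M \<dots> = emeasure ?M (?B b) - emeasure ?M (?B a)"
    using assms m by (intro emeasure_Diff) (auto simp: emeasure_PiM_cball)
  also have "\<dots> = ennreal (unit_ball_vol (real (card A)) * (b ^ card A - a ^ card A))"
    using assms by (simp add: emeasure_PiM_cball ennreal_minus right_diff_distrib)
  finally show ?thesis .
qed

text \<open>After squaring, this amounts to \<open>s^2 \<le> r^2\<close>: up to distance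
  \<open>r\<close> from the axis the cone is entered before the ball is left, so the shells below
  have ordered radii.\<close>

lemma cone_slope_le:
  assumes "0 < r" "r < 1" "0 \<le> s" "s \<le> (r::real)"
  shows "s * sqrt (1 - r\<^sup>2) / r \<le> sqrt (1 - s\<^sup>2)"
proof (rule real_le_rsqrt)
  have "s\<^sup>2 \<le> r\<^sup>2" using assms by (intro power_mono) auto
  moreover have "r\<^sup>2 < 1" using assms by (simp add: power_less_one_iff abs_square_less_1)
  ultimately show "(s * sqrt (1 - r\<^sup>2) / r)\<^sup>2 \<le> 1 - s\<^sup>2"
    using assms by (simp add: power_divide power_mult_distrib divide_simps algebra_simps)
qed

text \<open>Fix the \<open>K\<close>-part of a point, of norm \<open>s\<close>. The admissible
  \<open>J\<close>-parts contain a spherical shell of known volume, and integrating that volume over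
  \<open>K\<close> in polar coordinates gives the profile integral. Containment of the shells
  suffices for a lower bound.\<close>

lemma emeasure_PiM_cone:
  fixes r :: real and K J :: "'i set"
  assumes K: "finite K" "K \<noteq> {}" and J: "finite J" "J \<noteq> {}" and KJ: "K \<inter> J = {}"
    and r: "0 < r" "r < 1"
  shows "emeasure (Pi\<^sub>M (K \<union> J) (\<lambda>_. lborel)) {f \<in> space (Pi\<^sub>M (K \<union> J) (\<lambda>_. lborel)).
            sqrt (\<Sum>i\<in>K \<union> J. (f i)\<^sup>2) \<le> 1 \<and>
            sqrt (\<Sum>i\<in>K. (f i)\<^sup>2) < r * sqrt (\<Sum>i\<in>K \<union> J. (f i)\<^sup>2)} \<ge>
         ennreal (unit_ball_vol (card K) * unit_ball_vol (card J) *
           integral {0..r} (cone_profile r (card K) (card J)))"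
    (is "emeasure ?M ?S \<ge> _")
proof -
  interpret product_sigma_finite "\<lambda>_::'i. lborel :: real measure" ..
  define k where "k = card K"
  define d where "d = card J"
  \<comment> \<open>The cotangent of the half-angle \<open>arcsin r\<close> of the cone, i.e. the
    ratio of axial to transversal length on its boundary.\<close>
  define c where "c = sqrt (1 - r\<^sup>2) / r"
  define N where "N A f = sqrt (\<Sum>i\<in>A. (f i)\<^sup>2)" for A and f :: "'i \<Rightarrow> real"
  \<comment> \<open>The volume of the shell of \<open>J\<close>-parts belonging to a
    \<open>K\<close>-part of norm \<open>s\<close>, cut off at \<open>r\<close>, where the two radii
    meet.\<close>
  define h where "h s = indicator {0..r} s * ennreal (unit_ball_vol d * (sqrt (1 - s\<^sup>2) ^ d - (s * c) ^ d))" for s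
  have [measurable]: "h \<in> borel_measurable borel" unfolding h_def by measurable
  have c0: "c \<ge> 0" using r by (auto simp: c_def abs_square_le_1)
  have cs: "0 \<le> s * sqrt (1 - r\<^sup>2) / r" if "s \<in> {0..r}" for s
    using that c0 mult_nonneg_nonneg[of s c] by (auto simp: c_def)
  have S[measurable]: "?S \<in> sets ?M" using K J by measurable
  have le: "h (N K x) \<le> (\<integral>\<^sup>+y. indicator ?S (merge K J (x, y)) \<partial>Pi\<^sub>M J (\<lambda>_. lborel))"
    if x: "x \<in> space (Pi\<^sub>M K (\<lambda>_. lborel))" for x
  proof (cases "N K x \<in> {0..r}")
    case True
    define s where "s = N K x"
    have s: "0 \<le> s" "s \<le> r" using True by (auto simp: s_def)
    let ?T = "{y \<in> space (Pi\<^sub>M J (\<lambda>_. lborel)).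
           s * c < sqrt (\<Sum>i\<in>J. (y i)\<^sup>2) \<and> sqrt (\<Sum>i\<in>J. (y i)\<^sup>2) \<le> sqrt (1 - s\<^sup>2)}"
    have T: "?T \<in> sets (Pi\<^sub>M J (\<lambda>_. lborel))" using J by measurable
    have "s * c \<le> sqrt (1 - s\<^sup>2)"
      using cone_slope_le[OF r s] by (simp add: c_def)
    then have "h s = emeasure (Pi\<^sub>M J (\<lambda>_. lborel)) ?T"
      using s c0 J by (subst emeasure_PiM_shell) (auto simp: h_def d_def)
    also have "\<dots> = (\<integral>\<^sup>+y. indicator ?T y \<partial>Pi\<^sub>M J (\<lambda>_. lborel))"
      using T by simp
    also have "\<dots> \<le> (\<integral>\<^sup>+y. indicator ?S (merge K J (x, y)) \<partial>Pi\<^sub>M J (\<lambda>_. lborel))"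
    proof (rule nn_integral_mono)
      fix y
      have "merge K J (x, y) \<in> ?S" if y: "y \<in> ?T"
      proof -
        define t where "t = N J y"
        have t: "0 \<le> t" "s * c < t" "t \<le> sqrt (1 - s\<^sup>2)"
          using y by (auto simp: t_def N_def sum_nonneg)
        have sq: "(\<Sum>i\<in>K. (x i)\<^sup>2) = s\<^sup>2" "(\<Sum>i\<in>J. (y i)\<^sup>2) = t\<^sup>2"
          by (auto simp: s_def t_def N_def sum_nonneg)
        have sumK: "(\<Sum>i\<in>K. (merge K J (x, y) i)\<^sup>2) = s\<^sup>2"
          unfolding sq[symmetric] by (intro sum.cong) (auto simp: merge_def)
        have sumJ: "(\<Sum>i\<in>J. (merge K J (x, y) i)\<^sup>2) = t\<^sup>2"
          unfolding sq[symmetric] using KJ by (intro sum.cong) (auto simp: merge_def)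
        have sumKJ: "(\<Sum>i\<in>K \<union> J. (merge K J (x, y) i)\<^sup>2) = s\<^sup>2 + t\<^sup>2"
          unfolding sum.union_disjoint[OF K(1) J(1) KJ] sumK sumJ ..
        have s1: "s\<^sup>2 \<le> 1" using s r by (simp add: abs_square_le_1)
        have "t\<^sup>2 \<le> (sqrt (1 - s\<^sup>2))\<^sup>2" using t by (intro power_mono) auto
        then have "sqrt (s\<^sup>2 + t\<^sup>2) \<le> 1" using s1 by simp
        moreover have "s < r * sqrt (s\<^sup>2 + t\<^sup>2)"
        proof -
          \<comment> \<open>Clearing the denominator in \<open>s c < t\<close> and adding
            \<open>r^2 s^2\<close> to both sides turns it into the cone condition.\<close>
          have "(s * c)\<^sup>2 < t\<^sup>2" using t s c0 by (intro power_strict_mono) auto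
          then have "s\<^sup>2 * (1 - r\<^sup>2) < r\<^sup>2 * t\<^sup>2"
            using r by (simp add: c_def power_divide power_mult_distrib divide_simps abs_square_le_1 mult.commute)
          then have "s\<^sup>2 < (r * sqrt (s\<^sup>2 + t\<^sup>2))\<^sup>2"
            by (simp add: power_mult_distrib algebra_simps)
          then show ?thesis using r by (intro power_less_imp_less_base[of s 2]) auto
        qed
        moreover have "merge K J (x, y) \<in> space ?M"
          using x y by (auto simp: space_PiM PiE_def merge_def extensional_def)
        ultimately show ?thesis using s by (simp add: sumK sumKJ)
      qed
      then show "(indicator ?T y :: ennreal) \<le> indicator ?S (merge K J (x, y))"
        by (simp add: indicator_def)
    qed
    finally show ?thesis by (simp add: s_def)
  qed (simp add: h_def)
  have nonneg: "0 \<le> cone_profile r k d s" if "s \<in> {0..r}" for s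
    unfolding cone_profile_def using that r cone_slope_le[of r s]
      cs[OF that] by (intro mult_nonneg_nonneg) (auto intro!: power_mono)
  have cont: "continuous_on {0..r} (cone_profile r k d)"
    unfolding cone_profile_def using r by (intro continuous_intros) auto
  define I where "I = integral {0..r} (cone_profile r k d)"
  have "((\<lambda>s. unit_ball_vol k * unit_ball_vol d * cone_profile r k d s) has_integral
          unit_ball_vol k * unit_ball_vol d * I) {0..r}"
    unfolding I_def using integrable_continuous_interval[OF cont]
    by (intro has_integral_mult_right integrable_integral)
  from nn_integral_has_integral_lebesgue[OF _ this] nonneg
  have "ennreal (unit_ball_vol k * unit_ball_vol d * I) =
      (\<integral>\<^sup>+s. ennreal (indicator {0..r} s * (unit_ball_vol k * unit_ball_vol d * cone_profile r k d s)) \<partial>lborel)"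
    by simp
  also have "\<dots> = (\<integral>\<^sup>+s. ennreal (unit_ball_vol k * (k * s ^ (k - 1))) * indicator {0..} s * h s \<partial>lborel)"
  proof (rule nn_integral_cong)
    fix s :: real
    show "ennreal (indicator {0..r} s * (unit_ball_vol k * unit_ball_vol d * cone_profile r k d s)) =
          ennreal (unit_ball_vol k * (k * s ^ (k - 1))) * indicator {0..} s * h s"
    proof (cases "s \<in> {0..r}")
      case True
      have "sqrt (1 - s\<^sup>2) ^ d - (s * c) ^ d \<ge> 0"
        using True r cs[OF True] cone_slope_le[of r s] by (auto simp: c_def intro!: power_mono)
      then show ?thesis
        using True by (simp add: h_def cone_profile_def ennreal_mult'[symmetric] c_def mult_ac)
    qed (auto simp: h_def)
  qed
  also have "\<dots> = (\<integral>\<^sup>+x. h (N K x) \<partial>Pi\<^sub>M K (\<lambda>_. lborel))"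
    unfolding N_def k_def by (rule nn_integral_PiM_radial[symmetric]) (use K in auto)
  also have "\<dots> \<le> (\<integral>\<^sup>+x. \<integral>\<^sup>+y. indicator ?S (merge K J (x, y)) \<partial>Pi\<^sub>M J (\<lambda>_. lborel) \<partial>Pi\<^sub>M K (\<lambda>_. lborel))"
    by (intro nn_integral_mono le) auto
  also have "\<dots> = (\<integral>\<^sup>+f. indicator ?S f \<partial>?M)"
    by (rule product_nn_integral_fold[symmetric]) (use K J KJ in auto)
  also have "\<dots> = emeasure ?M ?S" by simp
  finally show ?thesis by (simp add: k_def d_def I_def)
qed

section \<open>Reduction of arbitrary subspaces to coordinate subspaces\<close>

text \<open>Orthonormal bases of \<open>W\<close> and of its orthogonal complement together form one
  of the whole space. Sending \<open>J\<close> to the first and the other basis vectors to the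
  second defines an isometry.\<close>

lemma orthogonal_transformation_onto_subspace:
  fixes W :: "'a::euclidean_space set"
  assumes W: "subspace W"
  obtains J and f :: "'a \<Rightarrow> 'a" where "J \<subseteq> Basis" "card J = dim W" "orthogonal_transformation f" "\<And>b. b \<in> J \<Longrightarrow> f b \<in> W"
proof -
  define V where "V = {y. \<forall>x\<in>W. orthogonal x y}"
  have V: "subspace V"
    unfolding V_def by (rule subspace_orthogonal_to_vectors)
  have dims: "dim V + dim W = DIM('a)"
    using dim_subspace_orthogonal_to_vectors[OF W subspace_UNIV] by (simp add: V_def)
  obtain B where B: "B \<subseteq> W" "pairwise orthogonal B" "\<And>x. x \<in> B \<Longrightarrow> norm x = 1"
    "independent B" "card B = dim W"
    using orthonormal_basis_subspace[OF W] by metis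
  obtain C where C: "C \<subseteq> V" "pairwise orthogonal C" "\<And>x. x \<in> C \<Longrightarrow> norm x = 1"
    "independent C" "card C = dim V"
    using orthonormal_basis_subspace[OF V] by metis
  have fin: "finite B" "finite C" using B C independent_imp_finite by blast+
  have "dim W \<le> card (Basis :: 'a set)" using dims by simp
  then obtain J where J: "J \<subseteq> (Basis :: 'a set)" "card J = dim W"
    using obtain_subset_with_card_n by metis
  have fJ: "finite J" "finite (Basis - J)" using finite_subset[OF J(1)] by auto
  have "card (Basis - J) = card C"
    using J C dims fJ by (simp add: card_Diff_subset)
  then obtain \<psi> where \<psi>: "bij_betw \<psi> (Basis - J) C"
    using fin fJ finite_same_card_bij by blast
  obtain \<phi> where \<phi>: "bij_betw \<phi> J B"
    using fin fJ J B finite_same_card_bij by metis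
  define e where "e b = (if b \<in> J then \<phi> b else \<psi> b)" for b
  have eJ: "e b \<in> B" if "b \<in> J" for b using that \<phi> by (auto simp: e_def bij_betw_def)
  have eC: "e b \<in> C" if "b \<in> Basis" "b \<notin> J" for b using that \<psi> by (auto simp: e_def bij_betw_def)
  have BC: "x \<bullet> y = 0" "y \<bullet> x = 0" if "x \<in> B" "y \<in> C" for x y
    using that B(1) C(1) by (auto simp: V_def orthogonal_def subset_iff inner_commute)
  have ee: "e b \<bullet> e b' = (if b = b' then 1 else 0)" if b: "b \<in> Basis" "b' \<in> Basis" for b b'
  proof (cases "b = b'")
    case True
    have "norm (e b) = 1" using eJ eC B(3) C(3) b by blast
    then show ?thesis using True by (simp add: norm_eq_1)
  next
    case False
    consider "b \<in> J" "b' \<in> J" | "b \<in> J" "b' \<notin> J" | "b \<notin> J" "b' \<in> J" | "b \<notin> J" "b' \<notin> J" by blast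
    then show ?thesis
    proof cases
      case 1
      then have "e b \<noteq> e b'" using False \<phi> by (auto simp: e_def bij_betw_def inj_on_def)
      then have "orthogonal (e b) (e b')" using 1 eJ B(2) by (auto simp: pairwise_def)
      then show ?thesis using False by (simp add: orthogonal_def)
    next
      case 4
      then have "e b \<noteq> e b'" using b False \<psi> by (auto simp: e_def bij_betw_def inj_on_def)
      then have "orthogonal (e b) (e b')" using 4 b eC C(2) by (auto simp: pairwise_def)
      then show ?thesis using False by (simp add: orthogonal_def)
    qed (use False b BC eJ eC in auto)
  qed
  define f where "f x = (\<Sum>b\<in>Basis. (x \<bullet> b) *\<^sub>R e b)" for x
  have "f v \<bullet> f w = v \<bullet> w" for v w
  proof -
    have ef: "e b \<bullet> f w = w \<bullet> b" if b: "b \<in> Basis" for b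
    proof -
      have "e b \<bullet> f w = (\<Sum>b'\<in>Basis. if b = b' then w \<bullet> b' else 0)"
        unfolding f_def inner_sum_right using b by (intro sum.cong refl) (simp add: ee)
      then show ?thesis using b by simp
    qed
    have "f v \<bullet> f w = (\<Sum>b\<in>Basis. (v \<bullet> b) * (e b \<bullet> f w))"
      unfolding f_def[of v] by (simp add: inner_sum_left)
    also have "\<dots> = (\<Sum>b\<in>Basis. (v \<bullet> b) * (w \<bullet> b))"
      by (simp add: ef)
    finally show ?thesis by (simp add: euclidean_inner[of v w])
  qed
  moreover have "linear f"
    unfolding f_def by (intro linearI) (auto simp: inner_add_left scaleR_add_left sum.distrib scaleR_sum_right)
  ultimately have "orthogonal_transformation f"
    by (simp add: orthogonal_transformation_def)
  moreover have "f b \<in> W" if b: "b \<in> J" for b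
  proof -
    have "f b = (\<Sum>b'\<in>Basis. if b = b' then e b' else 0)"
      unfolding f_def using b J by (intro sum.cong refl) (auto simp: inner_Basis)
    also have "\<dots> = e b" using b J by auto
    finally show ?thesis using eJ[OF b] B(1) by auto
  qed
  ultimately show thesis using J that by blast
qed

text \<open>A rotation taking the span of \<open>J\<close> into \<open>W\<close> maps the coordinate
  cone \<open>S0\<close> into the cone around \<open>W\<close> and preserves volume, so the bound
  for product measures carries over.\<close>

lemma emeasure_cone_subspace_ge:
  fixes W :: "'a::euclidean_space set" and r :: real
  assumes W: "subspace W" "0 < dim W" "dim W < DIM('a)" and r: "0 < r" "r < 1"
  shows "ennreal (unit_ball_vol (DIM('a) - dim W) * unit_ball_vol (dim W) *
           integral {0..r} (cone_profile r (DIM('a) - dim W) (dim W)))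
         \<le> emeasure lborel {x. norm x \<le> 1 \<and> (\<exists>w\<in>W. norm (x - w) < r * norm x)}"
    (is "_ \<le> emeasure lborel ?S")
proof -
  obtain J and f :: "'a \<Rightarrow> 'a" where J: "J \<subseteq> Basis" "card J = dim W" and f: "orthogonal_transformation f"
    and fJ: "\<And>b. b \<in> J \<Longrightarrow> f b \<in> W"
    using orthogonal_transformation_onto_subspace[OF W(1)] by metis
  have lin: "linear f" using f orthogonal_transformation_linear by blast
  have fm[measurable]: "f \<in> borel_measurable borel"
    using lin by (intro borel_measurable_continuous_onI linear_continuous_on linear_conv_bounded_linear[THEN iffD1])
  define K where "K = (Basis :: 'a set) - J"
  have fin: "finite J" "finite K" using finite_subset[OF J(1)] by (auto simp: K_def)
  have KJ: "K \<union> J = Basis" "K \<inter> J = {}" using J by (auto simp: K_def)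
  have cK: "card K = DIM('a) - dim W"
    using J fin by (simp add: K_def card_Diff_subset)
  have "card K > 0" "card J > 0" using cK J(2) W by simp_all
  then have ne: "K \<noteq> {}" "J \<noteq> {}" by auto
  have "?S = cball 0 1 \<inter> (\<Union>w\<in>W. {x. norm (x - w) < r * norm x})" by auto
  moreover have "open (\<Union>w\<in>W. {x. norm (x - w) < r * norm x})"
    by (intro open_UN ballI open_Collect_less continuous_intros)
  ultimately have S[measurable]: "?S \<in> sets borel" by auto
  define S0 where "S0 = {x::'a. norm x \<le> 1 \<and> sqrt (\<Sum>b\<in>K. (x \<bullet> b)\<^sup>2) < r * norm x}"
  have S0[measurable]: "S0 \<in> sets borel" unfolding S0_def using fin by measurable
  let ?P = "Pi\<^sub>M (K \<union> J) (\<lambda>_. lborel :: real measure)"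
  let ?T = "{g \<in> space ?P. sqrt (\<Sum>i\<in>K \<union> J. (g i)\<^sup>2) \<le> 1 \<and>
            sqrt (\<Sum>i\<in>K. (g i)\<^sup>2) < r * sqrt (\<Sum>i\<in>K \<union> J. (g i)\<^sup>2)}"
  have "ennreal (unit_ball_vol (DIM('a) - dim W) * unit_ball_vol (dim W) *
           integral {0..r} (cone_profile r (DIM('a) - dim W) (dim W))) \<le> emeasure ?P ?T"
    using emeasure_PiM_cone[OF fin(2) ne(1) fin(1) ne(2) KJ(2) r] unfolding cK J(2) .
  also have "\<dots> = emeasure lborel S0"
  proof -
    have "emeasure lborel S0 = emeasure ?P ((\<lambda>g. \<Sum>b\<in>Basis. g b *\<^sub>R b) -` S0 \<inter> space ?P)"
      unfolding KJ(1) by (subst lborel_eq, subst emeasure_distr) auto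
    also have "(\<lambda>g. \<Sum>b\<in>Basis. g b *\<^sub>R b) -` S0 \<inter> space ?P = ?T"
    proof -
      have n: "norm (\<Sum>b\<in>Basis. g b *\<^sub>R b :: 'a) = sqrt (\<Sum>i\<in>K \<union> J. (g i)\<^sup>2)" for g
        by (subst norm_eq_sqrt_inner, subst euclidean_inner) (simp add: KJ power2_eq_square)
      have "(\<Sum>b\<in>K. ((\<Sum>b\<in>Basis. g b *\<^sub>R b :: 'a) \<bullet> b)\<^sup>2) = (\<Sum>i\<in>K. (g i)\<^sup>2)" for g
        by (intro sum.cong refl) (auto simp: K_def)
      then show ?thesis using n by (auto simp: S0_def)
    qed
    finally show ?thesis ..
  qed
  also have "\<dots> \<le> emeasure lborel (f -` ?S)"
  proof (rule emeasure_mono)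
    show "f -` ?S \<in> sets lborel" using measurable_sets[OF fm S] by simp
    show "S0 \<subseteq> f -` ?S"
    proof
      fix x assume x: "x \<in> S0"
      \<comment> \<open>The orthogonal projection of \<open>x\<close> to the span of
        \<open>J\<close>. Its image \<open>f w\<close> is the point of \<open>W\<close> that
        witnesses membership in the cone.\<close>
      define w where "w = (\<Sum>b\<in>J. (x \<bullet> b) *\<^sub>R b)"
      have "f w = (\<Sum>b\<in>J. (x \<bullet> b) *\<^sub>R f b)"
        using lin by (simp add: w_def linear_sum linear_scale)
      then have "f w \<in> W" using fJ W(1) by (auto intro!: subspace_sum subspace_mul)
      moreover have "norm (f x - f w) = sqrt (\<Sum>b\<in>K. (x \<bullet> b)\<^sup>2)"
      proof -
        have wb: "w \<bullet> b = (if b \<in> J then x \<bullet> b else 0)" if "b \<in> Basis" for b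
        proof -
          have "w \<bullet> b = (\<Sum>b'\<in>J. if b = b' then x \<bullet> b' else 0)"
            unfolding w_def inner_sum_left using that J by (intro sum.cong refl) (auto simp: inner_Basis)
          then show ?thesis using fin by simp
        qed
        have "norm (f x - f w) = norm (x - w)"
          using orthogonal_transformation_norm[OF f, of "x - w"] linear_diff[OF lin, of x w] by simp
        also have "\<dots> = sqrt (\<Sum>b\<in>K \<union> J. ((x - w) \<bullet> b)\<^sup>2)"
          by (subst norm_eq_sqrt_inner, subst euclidean_inner) (simp add: KJ power2_eq_square)
        also have "(\<Sum>b\<in>K \<union> J. ((x - w) \<bullet> b)\<^sup>2) = (\<Sum>b\<in>K. ((x - w) \<bullet> b)\<^sup>2) + (\<Sum>b\<in>J. ((x - w) \<bullet> b)\<^sup>2)"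
          using fin KJ by (intro sum.union_disjoint)
        also have "(\<Sum>b\<in>J. ((x - w) \<bullet> b)\<^sup>2) = 0"
          using J wb by (intro sum.neutral) (auto simp: inner_diff_left)
        also have "(\<Sum>b\<in>K. ((x - w) \<bullet> b)\<^sup>2) = (\<Sum>b\<in>K. (x \<bullet> b)\<^sup>2)"
          using wb by (intro sum.cong refl) (auto simp: inner_diff_left K_def)
        finally show ?thesis by simp
      qed
      ultimately show "x \<in> f -` ?S"
        using x f by (auto simp: S0_def orthogonal_transformation_norm intro!: bexI[of _ "f w"])
    qed
  qed
  also have "\<dots> = emeasure (distr lborel borel f) ?S"
    by (subst emeasure_distr) auto
  also have "\<dots> = emeasure lborel ?S"
    by (simp add: lborel_distr_orthogonal_transformation[OF f])
  finally show ?thesis .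
qed

subsection \<open>Comparison of the cone volume with the bound\<close>

text \<open>The profile has no convenient antiderivative here, but a slightly smaller function
  \<open>g\<close> has one. Integration by parts of \<open>s^(k-1) W^(m+2)\<close> leaves the
  integrand \<open>s^(k+1) W^m\<close>, and there \<open>W\<close> is replaced by its least value
  \<open>q\<close> on the interval.\<close>

lemma integral_cone_profile_ge:
  assumes "0 < r" "r < 1" "k \<ge> 1"
  shows "real (m + 2) / real (m + 2 + k) * r ^ k * sqrt (1 - r\<^sup>2) ^ m \<le> integral {0..r} (cone_profile r k (m + 2))"
proof -
  define q where "q = sqrt (1 - r\<^sup>2)"
  have r1: "r\<^sup>2 < 1" using assms by (simp add: abs_square_less_1)
  have q: "q \<ge> 0" "q\<^sup>2 = 1 - r\<^sup>2" using r1 by (auto simp: q_def)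
  obtain j where k: "k = Suc j" using assms by (cases k) auto
  define W :: "real \<Rightarrow> real" where "W s = sqrt (1 - s\<^sup>2)" for s
  define G where "G s = s ^ k * W s ^ (m + 2) + real (m + 2) / real (k + 2) * q ^ m * s ^ (k + 2)
     - real k / real (m + 2 + k) * (q / r) ^ (m + 2) * s ^ (m + 2 + k)" for s :: real
  \<comment> \<open>The two middle terms add up to \<open>- (m + 2) s^(k+1) (W^m - q^m)\<close>,
    which is not positive on \<open>{0..r}\<close>; the outer two are the profile.\<close>
  define g where "g s = k * s ^ j * W s ^ (m + 2) - real (m + 2) * s ^ (k + 1) * W s ^ m
     + real (m + 2) * s ^ (k + 1) * q ^ m - k * s ^ j * (s * q / r) ^ (m + 2)" for s :: real
  have "(g has_integral (G r - G 0)) {0..r}"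
  proof (rule fundamental_theorem_of_calculus)
    fix s assume s: "s \<in> {0..r}"
    have "s\<^sup>2 \<le> r\<^sup>2" using s by (intro power_mono) auto
    then have pos: "1 - s\<^sup>2 > 0" using r1 by linarith
    have Wpos: "W s > 0" using pos by (simp add: W_def)
    have sq: "((\<lambda>s. W s ^ (m + 2)) has_real_derivative (- (real (m + 2) * s * W s ^ m))) (at s)"
    proof -
      have "(W has_real_derivative (- s * inverse (W s))) (at s)"
        unfolding W_def using pos by (auto intro!: derivative_eq_intros)
      from DERIV_power[OF this, of "m + 2"]
      have "((\<lambda>s. W s ^ (m + 2)) has_real_derivative
          real (m + 2) * (- s * inverse (W s) * W s ^ (m + 2 - Suc 0))) (at s)"
        by simp
      moreover have "real (m + 2) * (- s * inverse (W s) * W s ^ (m + 2 - Suc 0)) = - (real (m + 2) * s * W s ^ m)"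
        using Wpos by simp
      ultimately show ?thesis by (simp only:)
    qed
    define V where "V = (\<lambda>s. W s ^ (m + 2))"
    define a where "a = real (m + 2) / real (k + 2) * q ^ m"
    define b where "b = real k / real (m + 2 + k) * (q / r) ^ (m + 2)"
    have dV: "(V has_real_derivative (- (real (m + 2) * s * W s ^ m))) (at s)"
      unfolding V_def by (rule sq)
    have a: "a * real (k + 2) = real (m + 2) * q ^ m" by (simp add: a_def)
    have b: "b * real (m + 2 + k) = real k * (q / r) ^ (m + 2)"
      unfolding b_def by (simp add: divide_simps)
    have "((\<lambda>s. s ^ k * V s + a * s ^ (k + 2) - b * s ^ (m + 2 + k)) has_real_derivative
        real k * s ^ j * V s - real (m + 2) * s * W s ^ m * s ^ k + (a * real (k + 2)) * s ^ (k + 1)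
        - (b * real (m + 2 + k)) * s ^ (m + 1 + k)) (at s)"
      by (rule derivative_eq_intros dV refl)+ (simp add: k)
    moreover have "real k * s ^ j * V s - real (m + 2) * s * W s ^ m * s ^ k + (a * real (k + 2)) * s ^ (k + 1)
        - (b * real (m + 2 + k)) * s ^ (m + 1 + k) = g s"
      unfolding a b unfolding g_def V_def k by (simp add: power_mult_distrib power_divide power_add mult_ac)
    ultimately have "(G has_real_derivative g s) (at s)"
      unfolding G_def V_def a_def b_def by (simp only:)
    then show "(G has_vector_derivative g s) (at s within {0..r})"
      by (metis has_real_derivative_iff_has_vector_derivative has_vector_derivative_at_within)
  qed (use assms in auto)
  moreover have "g s \<le> cone_profile r k (m + 2) s" if s: "s \<in> {0..r}" for s
  proof -
    have "s\<^sup>2 \<le> r\<^sup>2" using s by (intro power_mono) auto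
    then have "q ^ m \<le> sqrt (1 - s\<^sup>2) ^ m" using r1 by (auto simp: q_def intro!: power_mono)
    then have "real (m + 2) * s ^ (k + 1) * q ^ m \<le> real (m + 2) * s ^ (k + 1) * sqrt (1 - s\<^sup>2) ^ m"
      using s by (intro mult_left_mono) auto
    then show ?thesis
      by (simp add: g_def cone_profile_def W_def k q_def right_diff_distrib)
  qed
  moreover have "continuous_on {0..r} (cone_profile r k (m + 2))"
    unfolding cone_profile_def using assms by (intro continuous_intros) auto
  ultimately have "G r - G 0 \<le> integral {0..r} (cone_profile r k (m + 2))"
    by (intro has_integral_le[OF _ integrable_integral[OF integrable_continuous_interval]])
  \<comment> \<open>Two terms remain, with factors \<open>q^2\<close> and \<open>r^2\<close> and
    denominators \<open>m + 2 + k\<close> and \<open>k + 2\<close>. Enlarging the second denominator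
    to the first lets \<open>q^2 + r^2 = 1\<close> combine them.\<close>
  moreover have "real (m + 2) / real (m + 2 + k) * r ^ k * q ^ m \<le> G r - G 0"
  proof -
    have "G r - G 0 = real (m + 2) / real (m + 2 + k) * r ^ k * q ^ m * q\<^sup>2
        + real (m + 2) / real (k + 2) * r ^ k * q ^ m * r\<^sup>2"
    proof -
      have "(q / r) ^ (m + 2) * r ^ (m + 2 + k) = r ^ k * q ^ (m + 2)"
        using assms by (simp add: power_divide power_add)
      moreover have "1 - real k / real (m + 2 + k) = real (m + 2) / real (m + 2 + k)"
        by (simp add: field_simps)
      moreover have "G r - G 0 = r ^ k * q ^ (m + 2) + real (m + 2) / real (k + 2) * q ^ m * r ^ (k + 2)
         - real k / real (m + 2 + k) * ((q / r) ^ (m + 2) * r ^ (m + 2 + k))"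
        by (simp add: G_def k q_def W_def)
      ultimately have "G r - G 0 = r ^ k * q ^ (m + 2) * (real (m + 2) / real (m + 2 + k)) + real (m + 2) / real (k + 2) * q ^ m * r ^ (k + 2)"
        by (metis (no_types, opaque_lifting) add_diff_eq diff_add_eq mult.commute mult.right_neutral right_diff_distrib')
      then show ?thesis by (simp add: power_add power2_eq_square mult_ac)
    qed
    moreover have "real (m + 2) / real (m + 2 + k) * r ^ k * q ^ m * r\<^sup>2 \<le> real (m + 2) / real (k + 2) * r ^ k * q ^ m * r\<^sup>2"
      using assms q by (intro mult_right_mono divide_left_mono) auto
    moreover have "real (m + 2) / real (m + 2 + k) * r ^ k * q ^ m * q\<^sup>2 + real (m + 2) / real (m + 2 + k) * r ^ k * q ^ m * r\<^sup>2
        = real (m + 2) / real (m + 2 + k) * r ^ k * q ^ m"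
      unfolding q(2) by (simp only: right_diff_distrib mult_1_right diff_add_cancel)
    ultimately show ?thesis by linarith
  qed
  ultimately show ?thesis by (simp add: q_def)
qed

text \<open>For \<open>d = 1\<close> the antiderivative is explicit: integration by parts and the
  substitution \<open>s = sin x\<close>. At \<open>r\<close> the two algebraic terms cancel and only
  the sine integral survives.\<close>

lemma integral_cone_profile_1:
  assumes "0 < r" "r < 1" "k \<ge> 1"
  shows "integral {0..r} (cone_profile r k 1) =
     real k / real (k + 1) * integral {0..arcsin r} (\<lambda>x. sin x ^ (k - 1))"
proof -
  define q where "q = sqrt (1 - r\<^sup>2)"
  have r1: "r\<^sup>2 < 1" using assms by (simp add: abs_square_less_1)
  obtain j where k: "k = Suc j" using assms by (cases k) auto
  define S where "S t = integral {0..t} (\<lambda>x. sin x ^ j :: real)" for t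
  define W :: "real \<Rightarrow> real" where "W s = sqrt (1 - s\<^sup>2)" for s
  define G where "G s = real k / real (k + 1) * (s ^ k * W s + S (arcsin s) - q / r * s ^ (k + 1))" for s
  have "(cone_profile r k 1 has_integral (G r - G 0)) {0..r}"
  proof (rule fundamental_theorem_of_calculus)
    fix s assume s: "s \<in> {0..r}"
    have "s\<^sup>2 \<le> r\<^sup>2" using s by (intro power_mono) auto
    then have pos: "1 - s\<^sup>2 > 0" using r1 by linarith
    have as: "0 \<le> arcsin t" "arcsin t \<le> arcsin r" if "t \<in> {0..r}" for t
      using arcsin_le_arcsin[of 0 t] arcsin_le_arcsin[of t r] that assms by auto
    \<comment> \<open>The integral function is differentiated only within its interval, so the chain
      rule is used in its version relative to a set and its image.\<close>
    have "(S has_real_derivative sin (arcsin s) ^ j) (at (arcsin s) within {0..arcsin r})"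
      unfolding S_def using as[OF s]
      by (intro integral_has_real_derivative) (auto intro!: continuous_intros)
    then have "(S has_real_derivative sin (arcsin s) ^ j) (at (arcsin s) within arcsin ` {0..r})"
      by (rule DERIV_subset) (use as in auto)
    moreover have "(arcsin has_real_derivative inverse (sqrt (1 - s\<^sup>2))) (at s within {0..r})"
      using s assms by (intro has_field_derivative_at_within[OF DERIV_arcsin]) auto
    ultimately have "(S \<circ> arcsin has_real_derivative sin (arcsin s) ^ j * inverse (sqrt (1 - s\<^sup>2))) (at s within {0..r})"
      by (rule DERIV_image_chain)
    then have dS: "((\<lambda>s. S (arcsin s)) has_real_derivative s ^ j * inverse (W s)) (at s within {0..r})"
      using s assms by (simp add: o_def W_def)
    have dW: "(W has_real_derivative (- s * inverse (W s))) (at s within {0..r})"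
      unfolding W_def using pos by (auto intro!: derivative_eq_intros)
    have w: "W s > 0" "W s * W s = 1 - s * s" using pos by (auto simp: W_def power2_eq_square)
    have ww: "W s * (W s * x) = (1 - s * s) * x" for x using w by (metis mult.assoc)
    have iw: "inverse (W s) - s * (s * inverse (W s)) = W s"
      using w by (simp add: field_simps)
    have "(G has_real_derivative real k / real (k + 1) *
        (real k * s ^ j * W s - s * inverse (W s) * s ^ k + s ^ j * inverse (W s)
         - q / r * (real (k + 1) * s ^ k))) (at s within {0..r})"
      unfolding G_def by (rule derivative_eq_intros dS dW refl)+ (simp add: k)
    moreover have "real k / real (k + 1) *
        (real k * s ^ j * W s - s * inverse (W s) * s ^ k + s ^ j * inverse (W s)
         - q / r * (real (k + 1) * s ^ k)) = cone_profile r k 1 s"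
    proof -
      have "s ^ j * inverse (W s) - s * inverse (W s) * s ^ k = s ^ j * (inverse (W s) - s * (s * inverse (W s)))"
        by (simp add: k algebra_simps)
      then have "real k * s ^ j * W s - s * inverse (W s) * s ^ k + s ^ j * inverse (W s)
         - q / r * (real (k + 1) * s ^ k) = real (k + 1) * (s ^ j * (W s - s * q / r))"
        unfolding iw by (simp add: k algebra_simps add_divide_distrib)
      then show ?thesis
        unfolding cone_profile_def W_def[of s, symmetric] q_def[symmetric] by (simp add: k)
    qed
    ultimately have "(G has_real_derivative cone_profile r k 1 s) (at s within {0..r})"
      by (simp only:)
    then show "(G has_vector_derivative cone_profile r k 1 s) (at s within {0..r})"
      by (simp add: has_real_derivative_iff_has_vector_derivative)
  qed (use assms in auto)
  moreover have "G r - G 0 = real k / real (k + 1) * S (arcsin r)"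
    using assms by (simp add: G_def k q_def W_def S_def)
  ultimately show ?thesis
    by (simp add: S_def k integral_unique)
qed

text \<open>The quotient of Gamma values is the binomial coefficient of \<open>tau\<close>. The
  identity follows from the Gamma formula for ball volumes and
  \<open>Gamma (x + 1) = x * Gamma x\<close>.\<close>

lemma unit_ball_vol_ratio:
  assumes "k \<ge> 1" "d \<ge> 1"
  shows "Gamma (real (d + k) / 2) / (Gamma (real k / 2 + 1) * Gamma (real d / 2)) * unit_ball_vol (d + k) =
    real d / real (d + k) * (unit_ball_vol k * unit_ball_vol d)"
proof -
  let ?D = "real (d + k)"
  have pos: "Gamma (real d / 2) > 0" "Gamma (real k / 2 + 1) > 0" "Gamma (?D / 2) > 0"
    using assms by (auto intro!: Gamma_real_pos)
  have G1: "Gamma (x + 1) = x * Gamma x" if "x > 0" for x :: real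
    using that nonpos_Ints_nonpos[of x] by (intro Gamma_plus1) auto
  have GD: "Gamma (?D / 2 + 1) = ?D / 2 * Gamma (?D / 2)"
    using assms by (intro G1) auto
  have Gd: "Gamma (real d / 2 + 1) = real d / 2 * Gamma (real d / 2)"
    using assms by (intro G1) auto
  have pipow: "pi powr (?D / 2) = pi powr (real k / 2) * pi powr (real d / 2)"
    by (simp add: powr_add[symmetric] add_divide_distrib add.commute)
  \<comment> \<open>The rest is rational arithmetic: \<open>a\<close>, \<open>b\<close>,
    \<open>g\<close> stand for the three Gamma values, \<open>x\<close>, \<open>y\<close> for powers
    of \<open>pi\<close>, and \<open>n\<close>, \<open>m\<close> for the two dimensions.\<close>
  have arith: "a / (b * g) * (x * y / (n / 2 * a)) = m / n * (x / b * (y / (m / 2 * g)))"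
    if "a > 0" "b > 0" "g > 0" "n > 0" "m > 0" for a b g n m x y :: real
    using that by (simp add: field_simps)
  show ?thesis
    unfolding unit_ball_vol_def GD Gd pipow using pos assms by (intro arith) auto
qed

lemma tau_mult_unit_ball_vol_le:
  assumes "0 < r" "r < 1" "k \<ge> 1" "d \<ge> 1"
  shows "tau r d (d + k) * unit_ball_vol (d + k) \<le>
    unit_ball_vol k * unit_ball_vol d * integral {0..r} (cone_profile r k d)"
proof -
  define c where "c = Gamma (real (d + k) / 2) / (Gamma (real k / 2 + 1) * Gamma (real d / 2))"
  have ratio: "c * unit_ball_vol (d + k) = real d / real (d + k) * (unit_ball_vol k * unit_ball_vol d)"
    unfolding c_def by (rule unit_ball_vol_ratio) (use assms in auto)
  have binom: "real_binomial ((real (d + k) - 2) / 2) ((real (d + k) - real d) / 2) = c"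
  proof -
    have "(real (d + k) - 2) / 2 + 1 = real (d + k) / 2"
      "(real (d + k) - real d) / 2 + 1 = real k / 2 + 1"
      "(real (d + k) - 2) / 2 - (real (d + k) - real d) / 2 + 1 = real d / 2"
      by (simp_all add: field_simps)
    then show ?thesis unfolding real_binomial_def c_def by (simp only:)
  qed
  show ?thesis
  proof (cases "d = 1")
    case True
    define S where "S = integral {0..arcsin r} (\<lambda>x. sin x ^ (k - 1))"
    have "tau r d (d + k) = real k * c * S"
      using binom unfolding tau_def True S_def by simp
    then have "tau r d (d + k) * unit_ball_vol (d + k) = real k * S * (c * unit_ball_vol (d + k))"
      by (simp only: mult_ac)
    also have "\<dots> = unit_ball_vol k * unit_ball_vol d * (real k / real (k + 1) * S)"
      unfolding ratio by (simp add: True add.commute)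
    also have "real k / real (k + 1) * S = integral {0..r} (cone_profile r k d)"
      unfolding True S_def by (rule integral_cone_profile_1[symmetric]) (use assms in auto)
    finally show ?thesis by simp
  next
    case False
    define m where "m = d - 2"
    have d: "d = m + 2" using False assms by (simp add: m_def)
    have r2: "1 - r\<^sup>2 > 0" using assms by (simp add: abs_square_less_1)
    have "(1 - r\<^sup>2) powr ((real d - 2) / 2) = sqrt (1 - r\<^sup>2) ^ m"
      using r2 by (simp add: d powr_half_sqrt[symmetric] powr_powr flip: powr_realpow)
    then have "tau r d (d + k) = c * r ^ k * sqrt (1 - r\<^sup>2) ^ m"
      unfolding tau_def binom using False by simp
    then have "tau r d (d + k) * unit_ball_vol (d + k) = r ^ k * sqrt (1 - r\<^sup>2) ^ m * (c * unit_ball_vol (d + k))"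
      by (simp only: mult_ac)
    also have "\<dots> = unit_ball_vol k * unit_ball_vol d * (real d / real (d + k) * r ^ k * sqrt (1 - r\<^sup>2) ^ m)"
      unfolding ratio by simp
    also have "\<dots> \<le> unit_ball_vol k * unit_ball_vol d * integral {0..r} (cone_profile r k d)"
      unfolding d by (intro mult_left_mono integral_cone_profile_ge) (use assms in auto)
    finally show ?thesis .
  qed
qed

subsection \<open>Gaussian matrices\<close>

lemma bij_betw_matrix_Basis:
  "bij_betw (\<lambda>(i, j). axis i (axis j 1)) UNIV (Basis :: (real^'d^'D) set)"
  unfolding bij_betw_def
proof
  show "inj (\<lambda>(i, j). axis i (axis j 1) :: real^'d^'D)"
    by (auto simp: inj_def axis_eq_axis)
  show "range (\<lambda>(i, j). axis i (axis j 1)) = (Basis :: (real^'d^'D) set)"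
    by (auto simp: Basis_vec_def)
qed

lemma measurable_matrix_of_entries [measurable]:
  "(\<lambda>g. (\<chi> i j. g (i, j)) :: real^'d^'D) \<in> borel_measurable (Pi\<^sub>M UNIV (\<lambda>_. borel))"
proof (subst borel_measurable_euclidean_space, intro ballI)
  fix b :: "real^'d^'D" assume "b \<in> Basis"
  then obtain i j where b: "b = axis i (axis j 1)" by (auto simp: Basis_vec_def)
  have "(\<lambda>g. (\<chi> i j. g (i, j)) \<bullet> b) = (\<lambda>g. g (i, j))"
    by (simp add: b inner_axis)
  then show "(\<lambda>g. (\<chi> i j. g (i, j)) \<bullet> b) \<in> borel_measurable (Pi\<^sub>M UNIV (\<lambda>_. borel))"
    by simp
qed

text \<open>Lebesgue measure is determined by its values on boxes, and a box of matrices is a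
  product of intervals over the entries. This lets independence of the entries be expressed as a
  density on matrices.\<close>

lemma lborel_matrix_eq:
  "(lborel :: (real^'d^'D) measure) =
     distr (Pi\<^sub>M UNIV (\<lambda>_. lborel)) borel (\<lambda>g. \<chi> i j. g (i, j))"
proof (rule lborel_eqI)
  interpret product_sigma_finite "\<lambda>_ :: 'D \<times> 'd. lborel :: real measure" ..
  let ?m = "\<lambda>g. (\<chi> i j. g (i, j)) :: real^'d^'D"
  have [measurable]: "?m \<in> borel_measurable (Pi\<^sub>M UNIV (\<lambda>_. lborel))"
    using measurable_matrix_of_entries by (subst measurable_cong_sets[OF sets_PiM_cong refl]) auto
  fix l u :: "real^'d^'D" assume lu: "\<And>b. b \<in> Basis \<Longrightarrow> l \<bullet> b \<le> u \<bullet> b"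
  have le: "l $ i $ j \<le> u $ i $ j" for i j
    using lu[of "axis i (axis j 1)"] by (simp add: inner_axis)
  have "emeasure (distr (Pi\<^sub>M UNIV (\<lambda>_. lborel)) borel ?m) (box l u) =
      emeasure (Pi\<^sub>M UNIV (\<lambda>_. lborel)) (Pi\<^sub>E UNIV (\<lambda>(i, j). {l $ i $ j <..< u $ i $ j}))"
    by (subst emeasure_distr)
      (auto intro!: arg_cong[where f="emeasure _"] simp: mem_box Basis_vec_def inner_axis space_PiM PiE_def Pi_def)
  also have "\<dots> = (\<Prod>(i, j)\<in>UNIV. ennreal (u $ i $ j - l $ i $ j))"
    by (subst emeasure_PiM) (auto intro!: prod.cong simp: le)
  also have "\<dots> = (\<Prod>ij\<in>UNIV. ennreal ((u - l) \<bullet> (case ij of (i, j) \<Rightarrow> axis i (axis j 1))))"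
    by (intro prod.cong) (auto simp: inner_axis)
  also have "\<dots> = (\<Prod>b\<in>Basis. ennreal ((u - l) \<bullet> b))"
    by (rule prod.reindex_bij_betw[OF bij_betw_matrix_Basis])
  also have "\<dots> = ennreal (\<Prod>b\<in>Basis. (u - l) \<bullet> b)"
    using lu by (intro prod_ennreal) (auto simp: inner_diff_left)
  finally show "emeasure (distr (Pi\<^sub>M UNIV (\<lambda>_. lborel)) borel ?m) (box l u) =
      ennreal (\<Prod>b\<in>Basis. (u - l) \<bullet> b)" .
qed simp

lemma PiM_density_lborel:
  fixes f :: "real \<Rightarrow> ennreal"
  assumes I: "finite I" and f[measurable]: "f \<in> borel_measurable borel"
    and prob: "prob_space (density lborel f)"
  shows "Pi\<^sub>M I (\<lambda>_. density lborel f) = density (Pi\<^sub>M I (\<lambda>_. lborel)) (\<lambda>g. \<Prod>i\<in>I. f (g i))"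
proof -
  interpret prob_space "density lborel f" by (rule prob)
  interpret D: product_sigma_finite "\<lambda>_. density lborel f" ..
  interpret L: product_sigma_finite "\<lambda>_. lborel :: real measure" ..
  have "density (Pi\<^sub>M I (\<lambda>_. lborel)) (\<lambda>g. \<Prod>i\<in>I. f (g i)) = Pi\<^sub>M I (\<lambda>_. density lborel f)"
  proof (rule D.PiM_eqI[OF I])
    show "sets (density (Pi\<^sub>M I (\<lambda>_. lborel)) (\<lambda>g. \<Prod>i\<in>I. f (g i))) = sets (Pi\<^sub>M I (\<lambda>_. density lborel f))"
      by (simp add: sets_density cong: sets_PiM_cong)
    fix A assume A: "\<And>i. i \<in> I \<Longrightarrow> A i \<in> sets (density lborel f)"
    then have [measurable]: "i \<in> I \<Longrightarrow> A i \<in> sets borel" for i by simp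
    have AM: "Pi\<^sub>E I A \<in> sets (Pi\<^sub>M I (\<lambda>_. lborel))"
      using A I by (intro sets_PiM_I_finite) auto
    have "emeasure (density (Pi\<^sub>M I (\<lambda>_. lborel)) (\<lambda>g. \<Prod>i\<in>I. f (g i))) (Pi\<^sub>E I A) =
       (\<integral>\<^sup>+g. (\<Prod>i\<in>I. f (g i)) * indicator (Pi\<^sub>E I A) g \<partial>Pi\<^sub>M I (\<lambda>_. lborel))"
      using AM I by (intro emeasure_density) auto
    also have "\<dots> = (\<integral>\<^sup>+g. (\<Prod>i\<in>I. f (g i) * indicator (A i) (g i)) \<partial>Pi\<^sub>M I (\<lambda>_. lborel))"
    proof (rule nn_integral_cong)
      fix g assume g: "g \<in> space (Pi\<^sub>M I (\<lambda>_. lborel :: real measure))"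
      have "(indicator (Pi\<^sub>E I A) g :: ennreal) = (\<Prod>i\<in>I. indicator (A i) (g i))"
        using g I by (auto simp: indicator_def space_PiM PiE_def Pi_def prod_zero_iff)
      then show "(\<Prod>i\<in>I. f (g i)) * indicator (Pi\<^sub>E I A) g = (\<Prod>i\<in>I. f (g i) * indicator (A i) (g i))"
        by (simp add: prod.distrib)
    qed
    also have "\<dots> = (\<Prod>i\<in>I. \<integral>\<^sup>+x. f x * indicator (A i) x \<partial>lborel)"
      using I by (intro L.product_nn_integral_prod) auto
    also have "\<dots> = (\<Prod>i\<in>I. emeasure (density lborel f) (A i))"
      by (intro prod.cong refl) (simp add: emeasure_density)
    finally show "emeasure (density (Pi\<^sub>M I (\<lambda>_. lborel)) (\<lambda>g. \<Prod>i\<in>I. f (g i))) (Pi\<^sub>E I A) =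
      (\<Prod>i\<in>I. emeasure (density lborel f) (A i))" .
  qed
  then show ?thesis ..
qed

lemma gaussian_matrix_measurable:
  fixes A :: "'w \<Rightarrow> real^'d^'D"
  assumes "gaussian_matrix M A"
  shows "A \<in> borel_measurable M"
proof (subst borel_measurable_euclidean_space, intro ballI)
  fix b :: "real^'d^'D" assume "b \<in> Basis"
  then obtain i j where b: "b = axis i (axis j 1)" by (auto simp: Basis_vec_def)
  have "(\<lambda>\<omega>. A \<omega> $ i $ j) \<in> borel_measurable M"
    using assms distributed_measurable[of M lborel "\<lambda>\<omega>. A \<omega> $ i $ j"]
    by (auto simp: gaussian_matrix_def)
  then show "(\<lambda>\<omega>. A \<omega> \<bullet> b) \<in> borel_measurable M"
    by (simp add: b inner_axis)
qed

text \<open>A product of standard normal densities is a constant times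
  \<open>exp (- t^2 / 2)\<close>, where \<open>t\<close> is the Frobenius norm. Only this radial
  form is kept, since it already yields rotation invariance and absolute continuity.\<close>

lemma distr_gaussian_matrix:
  fixes A :: "'w \<Rightarrow> real^'d^'D"
  assumes "prob_space M" and A: "gaussian_matrix M A"
  obtains h :: "real \<Rightarrow> ennreal" where "h \<in> borel_measurable borel"
    "distr M borel A = density lborel (\<lambda>X. h (norm X))"
proof
  interpret prob_space M by fact
  define c where "c = (1 / sqrt (2 * pi)) ^ CARD('D \<times> 'd)"
  define h where "h t = ennreal (c * exp (- (t\<^sup>2 / 2)))" for t :: real
  show "h \<in> borel_measurable borel" unfolding h_def by measurable
  let ?\<phi> = "\<lambda>x. ennreal (std_normal_density x)"
  let ?X = "\<lambda>(i, j) \<omega>. A \<omega> $ i $ j"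
  let ?m = "\<lambda>g. (\<chi> i j. g (i, j)) :: real^'d^'D"
  have dist: "distributed M lborel (\<lambda>\<omega>. A \<omega> $ i $ j) std_normal_density" for i j
    using A by (simp add: gaussian_matrix_def)
  have rv: "random_variable borel (?X ij)" for ij
    using distributed_measurable[OF dist[of "fst ij" "snd ij"]] by (cases ij) simp
  have law: "distr M borel (?X ij) = density lborel ?\<phi>" for ij
    using distributed_distr_eq_density[OF dist[of "fst ij" "snd ij"]]
    by (cases ij) (simp cong: distr_cong)
  have P: "prob_space (density lborel ?\<phi>)"
    by (rule prob_space_normal_density) simp
  have indep: "indep_vars (\<lambda>_. borel) ?X UNIV"
    using A by (simp add: gaussian_matrix_def)
  have "distr M borel A = distr (distr M (Pi\<^sub>M UNIV (\<lambda>_. borel)) (\<lambda>\<omega>. \<lambda>ij\<in>UNIV. ?X ij \<omega>)) borel ?m"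
  proof (subst distr_distr)
    show "(\<lambda>\<omega>. \<lambda>ij\<in>UNIV. ?X ij \<omega>) \<in> measurable M (Pi\<^sub>M UNIV (\<lambda>_. borel))"
      by (intro measurable_restrict rv)
    have "?m \<circ> (\<lambda>\<omega>. \<lambda>ij\<in>UNIV. ?X ij \<omega>) = A"
      by (auto simp: fun_eq_iff vec_eq_iff)
    then show "distr M borel A = distr M borel (?m \<circ> (\<lambda>\<omega>. \<lambda>ij\<in>UNIV. ?X ij \<omega>))"
      by simp
  qed simp
  also have "distr M (Pi\<^sub>M UNIV (\<lambda>_. borel)) (\<lambda>\<omega>. \<lambda>ij\<in>UNIV. ?X ij \<omega>) = Pi\<^sub>M UNIV (\<lambda>_. density lborel ?\<phi>)"
    using indep_vars_iff_distr_eq_PiM[where I=UNIV and M'="\<lambda>_. borel" and X="?X", OF _ rv] indep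
    unfolding law by simp
  also have "\<dots> = density (Pi\<^sub>M UNIV (\<lambda>_. lborel)) (\<lambda>g. \<Prod>ij\<in>UNIV. ?\<phi> (g ij))"
    by (rule PiM_density_lborel[OF _ _ P]) auto
  also have "\<dots> = density (Pi\<^sub>M UNIV (\<lambda>_. lborel)) (\<lambda>g. h (norm (?m g)))"
  proof -
    have "(\<Prod>ij\<in>UNIV. ?\<phi> (g ij)) = h (norm (?m g))" for g :: "'D \<times> 'd \<Rightarrow> real"
    proof -
      have "(norm (?m g))\<^sup>2 = (\<Sum>i\<in>UNIV. \<Sum>j\<in>UNIV. (g (i, j))\<^sup>2)"
        unfolding power2_norm_eq_inner inner_vec_def by (simp add: power2_eq_square)
      also have "\<dots> = (\<Sum>ij\<in>UNIV. (g ij)\<^sup>2)"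
        by (simp add: sum.cartesian_product)
      finally have n: "(norm (?m g))\<^sup>2 = (\<Sum>ij\<in>UNIV. (g ij)\<^sup>2)" .
      have "(\<Prod>ij\<in>UNIV. std_normal_density (g ij)) = c * (\<Prod>ij\<in>UNIV. exp (- ((g ij)\<^sup>2 / 2)))"
        unfolding std_normal_density_def prod.distrib c_def by simp
      also have "(\<Prod>ij\<in>UNIV. exp (- ((g ij)\<^sup>2 / 2))) = exp (- ((norm (?m g))\<^sup>2 / 2))"
        unfolding n by (simp add: exp_sum[symmetric] sum_negf sum_divide_distrib)
      finally show ?thesis by (simp add: h_def prod_ennreal)
    qed
    then show ?thesis by simp
  qed
  also have "distr \<dots> borel ?m = density (distr (Pi\<^sub>M UNIV (\<lambda>_. lborel)) borel ?m) (\<lambda>X. h (norm X))"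
    by (rule density_distr[symmetric]) (auto simp: h_def)
  also have "\<dots> = density lborel (\<lambda>X. h (norm X))"
    unfolding lborel_matrix_eq[symmetric] ..
  finally show "distr M borel A = density lborel (\<lambda>X. h (norm X))" .
qed

section \<open>Rotation invariance of the matrix law\<close>

lemma distr_density_norm_orthogonal:
  fixes T :: "'a::euclidean_space \<Rightarrow> 'a"
  assumes T: "orthogonal_transformation T" and [measurable]: "h \<in> borel_measurable borel"
  shows "distr (density lborel (\<lambda>x. h (norm x))) borel T = density lborel (\<lambda>x. h (norm x))"
proof -
  have lin: "linear T" using T orthogonal_transformation_linear by blast
  have [measurable]: "T \<in> borel_measurable borel"
    using lin by (intro borel_measurable_continuous_onI linear_continuous_on linear_conv_bounded_linear[THEN iffD1])
  have "density (distr lborel borel T) (\<lambda>x. h (norm x)) = distr (density lborel (\<lambda>x. h (norm (T x)))) borel T"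
    by (rule density_distr) auto
  then show ?thesis
    by (simp add: lborel_distr_orthogonal_transformation[OF T] orthogonal_transformation_norm[OF T])
qed

text \<open>Multiplication by \<open>matrix f\<close> applies \<open>f\<close> to every column, and
  the inner product of matrices is the sum of the inner products of their columns.\<close>

lemma orthogonal_transformation_matrix_mult:
  fixes f :: "real^'D \<Rightarrow> real^'D"
  assumes f: "orthogonal_transformation f"
  shows "orthogonal_transformation (\<lambda>X :: real^'d^'D. matrix f ** X)"
proof -
  have lin: "linear f" using f orthogonal_transformation_linear by blast
  have cols: "X \<bullet> Y = (\<Sum>j\<in>UNIV. column j X \<bullet> column j Y)" for X Y :: "real^'d^'D"
    unfolding inner_vec_def column_def by (subst sum.swap) simp
  have col: "column j (matrix f ** X) = f (column j X)" for j and X :: "real^'d^'D"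
  proof -
    have "column j (matrix f ** X) = matrix f *v column j X"
      by (simp add: column_def matrix_matrix_mult_def matrix_vector_mult_def vec_eq_iff)
    then show ?thesis using lin by simp
  qed
  have "linear (\<lambda>X :: real^'d^'D. matrix f ** X)"
    by (intro linearI)
      (simp_all add: matrix_matrix_mult_def vec_eq_iff distrib_left sum.distrib sum_distrib_left mult_ac)
  then show ?thesis
    using f by (simp add: orthogonal_transformation_def cols col)
qed

section \<open>Probability that the range comes close to a direction\<close>

text \<open>The tolerance is relative to \<open>norm x\<close>, so for nonzero \<open>x\<close> only
  the direction matters. The strict inequality makes the sets open.\<close>

definition near_range :: "real \<Rightarrow> real^'D \<Rightarrow> (real^'d^'D) set" where
  "near_range r x = {X. \<exists>y. norm (x - X *v y) < r * norm x}"

text \<open>Openness in both variables jointly provides the product measurability needed to exchange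
  the integrals over \<open>x\<close> and over matrices.\<close>

lemma open_near_range_graph:
  "open {(x, X :: real^'d^'D). X \<in> near_range r x}"
proof -
  have "{(x, X :: real^'d^'D). X \<in> near_range r x} = (\<Union>y. {p. norm (fst p - snd p *v y) < r * norm (fst p)})"
    by (auto simp: near_range_def)
  moreover have "continuous_on UNIV (\<lambda>p :: (real^'D) \<times> (real^'d^'D). snd p *v y)" for y
    unfolding matrix_vector_mult_def by (intro continuous_intros)
  ultimately show ?thesis
    by (auto intro!: open_UN open_Collect_less continuous_intros)
qed

lemma near_range_borel [measurable]:
  "near_range r (x :: real^'D) \<in> sets (borel :: (real^'d^'D) measure)"
proof -
  have "near_range r x = (\<lambda>X :: real^'d^'D. (x, X)) -` {(x, X). X \<in> near_range r x}" by auto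
  moreover have "open \<dots>"
    by (intro open_vimage open_near_range_graph continuous_intros)
  ultimately show ?thesis by (simp add: borel_open)
qed

text \<open>Rescaling the witness \<open>y\<close> by \<open>norm x\<close> passes from
  \<open>x\<close> to its direction, and the isometry \<open>f\<close> then carries distances at
  \<open>u\<close> to distances at that direction.\<close>

lemma near_range_vimage_orthogonal:
  fixes f :: "real^'D \<Rightarrow> real^'D"
  assumes f: "orthogonal_transformation f" and x: "x \<noteq> 0" and fu: "f u = x /\<^sub>R norm x"
  shows "(\<lambda>X :: real^'d^'D. matrix f ** X) -` near_range r x = near_range r u"
proof -
  have lin: "linear f" using f orthogonal_transformation_linear by blast
  have nx: "norm x > 0" using x by simp
  have u: "norm u = 1"
    using orthogonal_transformation_norm[OF f, of u] nx by (simp add: fu)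
  have eq: "norm (x - (matrix f ** X) *v (norm x *\<^sub>R y)) = norm x * norm (u - X *v y)" for X :: "real^'d^'D" and y
  proof -
    have "(matrix f ** X) *v (norm x *\<^sub>R y) = norm x *\<^sub>R f (X *v y)"
      using lin by (simp add: matrix_vector_mul_assoc[symmetric] matrix_vector_mult_scaleR linear_scale)
    moreover have "x = norm x *\<^sub>R f u" using nx by (simp add: fu)
    ultimately have "x - (matrix f ** X) *v (norm x *\<^sub>R y) = norm x *\<^sub>R f (u - X *v y)"
      using lin by (metis linear_diff scaleR_right_diff_distrib)
    then show ?thesis by (simp add: orthogonal_transformation_norm[OF f])
  qed
  have "(\<exists>y. norm (x - (matrix f ** X) *v y) < r * norm x) \<longleftrightarrow> (\<exists>y. norm (u - X *v y) < r)" for X :: "real^'d^'D"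
  proof
    assume "\<exists>y. norm (x - (matrix f ** X) *v y) < r * norm x"
    then obtain y where y: "norm (x - (matrix f ** X) *v y) < r * norm x" by blast
    have "y = norm x *\<^sub>R (y /\<^sub>R norm x)" using nx by simp
    then have "norm x * norm (u - X *v (y /\<^sub>R norm x)) < r * norm x" using y eq by metis
    then have "norm (u - X *v (y /\<^sub>R norm x)) < r" using nx by (simp add: mult.commute)
    then show "\<exists>y. norm (u - X *v y) < r" by blast
  next
    assume "\<exists>y. norm (u - X *v y) < r"
    then obtain y where "norm (u - X *v y) < r" by blast
    then have "norm (x - (matrix f ** X) *v (norm x *\<^sub>R y)) < r * norm x"
      unfolding eq using nx by (simp add: mult.commute)
    then show "\<exists>y. norm (x - (matrix f ** X) *v y) < r * norm x" by blast
  qed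
  then show ?thesis by (auto simp: near_range_def u)
qed

text \<open>The set of pairs \<open>(x, X)\<close> with \<open>x\<close> in the unit ball and the
  range of \<open>X\<close> near \<open>x\<close> is measured in both orders. Fixing
  \<open>X\<close> gives at least the cone volume \<open>c\<close>; fixing \<open>x\<close> gives at
  most the probability sought, whence division by the ball volume.\<close>

lemma emeasure_near_range_ge_tau:
  fixes u :: "real^'D" and h :: "real \<Rightarrow> ennreal"
  defines "\<gamma> \<equiv> density lborel (\<lambda>X :: real^'d^'D. h (norm X))"
  assumes dD: "CARD('d) < CARD('D)" and r: "0 < r" "r < 1" and u: "norm u = 1"
    and h[measurable]: "h \<in> borel_measurable borel" and prob: "prob_space \<gamma>"
  shows "ennreal (tau r CARD('d) CARD('D)) \<le> emeasure \<gamma> (near_range r u)"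
proof -
  interpret \<gamma>: prob_space \<gamma> by (rule prob)
  interpret P: pair_sigma_finite "lborel :: (real^'D) measure" \<gamma> ..
  have sets\<gamma>: "sets \<gamma> = sets borel" by (simp add: \<gamma>_def)
  define d k where "d = CARD('d)" and "k = CARD('D) - CARD('d)"
  have dk: "d \<ge> 1" "k \<ge> 1" "CARD('D) = d + k" using dD by (auto simp: d_def k_def Suc_le_eq)
  define B where "B = cball (0 :: real^'D) 1"
  have [measurable]: "B \<in> sets borel" by (simp add: B_def)
  define G where "G = {(x, X :: real^'d^'D). X \<in> near_range r x}"
  have "G \<in> sets (borel \<Otimes>\<^sub>M borel)"
    unfolding borel_prod G_def by (intro borel_open open_near_range_graph)
  also have "sets (borel \<Otimes>\<^sub>M borel) = sets (lborel \<Otimes>\<^sub>M \<gamma>)"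
    by (intro sets_pair_measure_cong) (simp_all add: sets\<gamma>)
  finally have G[measurable]: "G \<in> sets (lborel \<Otimes>\<^sub>M \<gamma>)" .
  define c where "c = unit_ball_vol k * unit_ball_vol d * integral {0..r} (cone_profile r k d)"
  have const: "emeasure \<gamma> (near_range r x) = emeasure \<gamma> (near_range r u)" if x: "x \<noteq> 0" for x :: "real^'D"
  proof -
    have "norm u = norm (x /\<^sub>R norm x)" using u x by simp
    then obtain f where f: "orthogonal_transformation f" "f u = x /\<^sub>R norm x"
      using orthogonal_transformation_exists by blast
    let ?T = "\<lambda>X :: real^'d^'D. matrix f ** X"
    have T: "orthogonal_transformation ?T" by (rule orthogonal_transformation_matrix_mult[OF f(1)])
    then have "linear ?T" using orthogonal_transformation_linear by blast
    then have Tm: "?T \<in> borel_measurable borel"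
      by (intro borel_measurable_continuous_onI linear_continuous_on linear_conv_bounded_linear[THEN iffD1])
    have "emeasure \<gamma> (near_range r x) = emeasure (distr \<gamma> borel ?T) (near_range r x)"
      unfolding \<gamma>_def distr_density_norm_orthogonal[OF T h] ..
    also have "\<dots> = emeasure \<gamma> (?T -` near_range r x \<inter> space \<gamma>)"
      using Tm by (intro emeasure_distr) (simp_all add: measurable_cong_sets[OF sets\<gamma> refl])
    also have "?T -` near_range r x \<inter> space \<gamma> = near_range r u"
      using near_range_vimage_orthogonal[OF f(1) x f(2)] sets_eq_imp_space_eq[OF sets\<gamma>] by simp
    finally show ?thesis .
  qed
  have "ennreal c \<le> (\<integral>\<^sup>+x. indicator B x * indicator G (x, X) \<partial>lborel)" if X: "inj ((*v) X)" for X :: "real^'d^'D"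
  proof -
    have W: "subspace (range ((*v) X))" by (simp add: linear_subspace_image)
    have dimW: "dim (range ((*v) X)) = d"
      using dim_image_eq[of "(*v) X" UNIV] X by (simp add: d_def)
    have "ennreal c \<le> emeasure lborel {x. norm x \<le> 1 \<and> (\<exists>w\<in>range ((*v) X). norm (x - w) < r * norm x)}"
      using emeasure_cone_subspace_ge[OF W _ _ r] dk unfolding dimW c_def by simp
    also have "{x. norm x \<le> 1 \<and> (\<exists>w\<in>range ((*v) X). norm (x - w) < r * norm x)} =
       B \<inter> (\<lambda>x. (x, X)) -` G"
      by (auto simp: B_def G_def near_range_def)
    also have "emeasure lborel \<dots> = (\<integral>\<^sup>+x. indicator (B \<inter> (\<lambda>x. (x, X)) -` G) x \<partial>lborel)"
    proof (rule nn_integral_indicator[symmetric])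
      have "open ((\<lambda>x. (x, X)) -` G)"
        unfolding G_def by (intro open_vimage open_near_range_graph continuous_intros)
      then show "B \<inter> (\<lambda>x. (x, X)) -` G \<in> sets lborel" by simp
    qed
    also have "\<dots> = (\<integral>\<^sup>+x. indicator B x * indicator G (x, X) \<partial>lborel)"
      by (intro nn_integral_cong) (auto simp: indicator_def)
    finally show ?thesis .
  qed
  \<comment> \<open>The law has a density, so matrices of deficient rank, a Lebesgue null set, are
    negligible and the range has dimension \<open>d\<close> almost surely.\<close>
  moreover have "AE X in \<gamma>. inj ((*v) X)"
    unfolding \<gamma>_def using AE_lborel_inj_matrix[where 'd='d and 'D='D] dD
    by (subst AE_density) auto
  ultimately have "AE X in \<gamma>. ennreal c \<le> (\<integral>\<^sup>+x. indicator B x * indicator G (x, X) \<partial>lborel)"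
    by auto
  then have "(\<integral>\<^sup>+X. ennreal c \<partial>\<gamma>) \<le> (\<integral>\<^sup>+X. \<integral>\<^sup>+x. indicator B x * indicator G (x, X) \<partial>lborel \<partial>\<gamma>)"
    by (rule nn_integral_mono_AE)
  then have "ennreal c \<le> (\<integral>\<^sup>+X. \<integral>\<^sup>+x. indicator B x * indicator G (x, X) \<partial>lborel \<partial>\<gamma>)"
    by (simp add: \<gamma>.emeasure_space_1)
  also have "\<dots> = (\<integral>\<^sup>+x. \<integral>\<^sup>+X. indicator B x * indicator G (x, X) \<partial>\<gamma> \<partial>lborel)"
    by (rule P.Fubini') measurable
  also have "\<dots> \<le> (\<integral>\<^sup>+x. indicator B x * emeasure \<gamma> (near_range r u) \<partial>lborel)"
  proof (rule nn_integral_mono)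
    fix x :: "real^'D"
    have "(\<integral>\<^sup>+X. indicator B x * indicator G (x, X) \<partial>\<gamma>) = (\<integral>\<^sup>+X. indicator B x * indicator (near_range r x) X \<partial>\<gamma>)"
      by (intro nn_integral_cong) (auto simp: G_def indicator_def)
    also have "\<dots> = indicator B x * emeasure \<gamma> (near_range r x)"
      by (subst nn_integral_cmult) (auto simp: sets\<gamma> intro!: borel_measurable_indicator)
    also have "\<dots> \<le> indicator B x * emeasure \<gamma> (near_range r u)"
    \<comment> \<open>The origin has no direction, but no matrix is near it: the condition would ask
      for a norm below 0.\<close>
    proof (cases "x = 0")
      case True
      then have "near_range r x = ({} :: (real^'d^'D) set)" by (auto simp: near_range_def)
      then show ?thesis by simp
    qed (simp add: const)
    finally show "(\<integral>\<^sup>+X. indicator B x * indicator G (x, X) \<partial>\<gamma>) \<le> indicator B x * emeasure \<gamma> (near_range r u)" .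
  qed
  also have "\<dots> = emeasure lborel B * emeasure \<gamma> (near_range r u)"
    by (subst nn_integral_multc) auto
  also have "emeasure lborel B = ennreal (unit_ball_vol (d + k))"
    by (simp add: B_def emeasure_cball dk(3))
  finally have "ennreal c \<le> ennreal (unit_ball_vol (d + k)) * emeasure \<gamma> (near_range r u)" .
  moreover have "tau r d (d + k) * unit_ball_vol (d + k) \<le> c"
    unfolding c_def by (rule tau_mult_unit_ball_vol_le) (use r dk in auto)
  ultimately have "ennreal (tau r d (d + k) * unit_ball_vol (d + k)) \<le>
      ennreal (unit_ball_vol (d + k) * measure \<gamma> (near_range r u))"
    by (metis \<gamma>.emeasure_eq_measure ennreal_leI ennreal_mult' order_trans unit_ball_vol_nonneg of_nat_0_le_iff)
  then have "unit_ball_vol (d + k) * tau r d (d + k) \<le> unit_ball_vol (d + k) * measure \<gamma> (near_range r u)"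
    by (subst (asm) ennreal_le_iff) (auto simp: mult.commute)
  then have "tau r d (d + k) \<le> measure \<gamma> (near_range r u)"
    using unit_ball_vol_pos[of "real (d + k)"] by (subst (asm) mult_le_cancel_left_pos) auto
  then show ?thesis
    by (simp add: \<gamma>.emeasure_eq_measure ennreal_leI d_def dk(3)[symmetric, unfolded d_def])
qed

section \<open>From closeness of the range to success of the reduced problem\<close>

theorem theorem4p4:
  fixes M :: "'w measure"
    and A :: "'w \<Rightarrow> real ^ 'd::finite ^ 'D::finite"
    and X :: "(real ^ 'D) set"
    and f :: "real ^ 'D \<Rightarrow> real"
    and L \<epsilon> R_max :: real
    and xstar :: "real ^ 'D"
  assumes "CARD('d) < CARD('D)"
    and "interior X \<noteq> {}"
    and "L > 0"
    and "L-lipschitz_on X f"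
    and "prob_space M"
    and "gaussian_matrix M A"
    and "\<epsilon> > 0"
    and "is_arg_min f (\<lambda>x. x \<in> X) xstar"
    and "cball xstar (\<epsilon> / L) \<subseteq> X"
    and "R_max > \<epsilon> / L"
  shows "\<forall>p\<in>X. norm (p - xstar) < R_max \<longrightarrow>
           inner_prob M {\<omega> \<in> space M. eps_successful f X \<epsilon> p (A \<omega>)}
             \<ge> tau (\<epsilon> / (L * R_max)) CARD('d) CARD('D)"
proof (intro ballI impI)
  fix p assume p: "p \<in> X" "norm (p - xstar) < R_max"
  interpret prob_space M by fact
  define r where "r = \<epsilon> / (L * R_max)"
  have R: "R_max > 0" using assms(3,7,10) by (meson divide_pos_pos less_trans)
  have r: "0 < r" "r < 1" "r * R_max = \<epsilon> / L"
    using assms(3,7,10) R by (auto simp: r_def divide_simps mult.commute)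
  have min: "xstar \<in> X" "\<And>x. x \<in> X \<Longrightarrow> f xstar \<le> f x"
    using assms(8) by (auto simp: is_arg_min_def not_less)
  have Inf: "(INF x\<in>X. f x) = f xstar"
    using min by (intro cInf_eq_minimum) auto
  define v where "v = xstar - p"
  \<comment> \<open>For \<open>p = xstar\<close> an arbitrary unit vector is taken;
    \<open>v = norm v *\<^sub>R u\<close> still holds, so this case needs no separate
    treatment.\<close>
  define u where "u = (if v = 0 then axis undefined 1 else v /\<^sub>R norm v)"
  have u: "norm u = 1" "v = norm v *\<^sub>R u" by (auto simp: u_def norm_axis_1)
  have Am[measurable]: "A \<in> borel_measurable M"
    by (rule gaussian_matrix_measurable) fact
  obtain h :: "real \<Rightarrow> ennreal" where h: "h \<in> borel_measurable borel"
    and law: "distr M borel A = density lborel (\<lambda>X. h (norm X))"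
    using distr_gaussian_matrix assms(5,6) by blast
  have prob: "prob_space (density lborel (\<lambda>X :: real^'d^'D. h (norm X)))"
    unfolding law[symmetric] by (rule prob_space_distr) simp
  define E where "E = A -` near_range r u \<inter> space M"
  have E: "E \<in> sets M" unfolding E_def by measurable
  have "ennreal (tau r CARD('d) CARD('D)) \<le> emeasure (distr M borel A) (near_range r u)"
    unfolding law by (rule emeasure_near_range_ge_tau) (use assms(1) r u h prob in auto)
  also have "\<dots> = emeasure M E"
    unfolding E_def by (rule emeasure_distr) auto
  finally have tau: "tau r CARD('d) CARD('D) \<le> measure M E"
    by (simp add: emeasure_eq_measure)
  have "E \<subseteq> {\<omega> \<in> space M. eps_successful f X \<epsilon> p (A \<omega>)}"
  proof
    fix \<omega> assume "\<omega> \<in> E"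
    then obtain y where y: "norm (u - A \<omega> *v y) < r" and \<omega>: "\<omega> \<in> space M"
      using u by (auto simp: E_def near_range_def)
    \<comment> \<open>Scaling by \<open>norm v\<close> turns an error below \<open>r\<close> at
      \<open>u\<close> into one of at most \<open>R_max * r\<close>, which is
      \<open>\<epsilon> / L\<close>, at \<open>xstar\<close>. So \<open>z\<close> lies in the ball
      contained in \<open>X\<close>, where the Lipschitz bound applies.\<close>
    define z where "z = A \<omega> *v (norm v *\<^sub>R y) + p"
    have "xstar - z = norm v *\<^sub>R (u - A \<omega> *v y)"
      using u(2) by (simp add: z_def v_def matrix_vector_mult_scaleR scaleR_right_diff_distrib algebra_simps)
    then have "norm (xstar - z) = norm v * norm (u - A \<omega> *v y)" by simp
    also have "\<dots> \<le> R_max * r"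
      using p y R by (intro mult_mono) (auto simp: v_def norm_minus_commute)
    finally have z: "dist xstar z \<le> \<epsilon> / L" using r by (simp add: dist_norm mult.commute)
    then have zX: "z \<in> X" using assms(9) by auto
    have "dist (f z) (f xstar) \<le> L * dist z xstar"
      using assms(4) zX min(1) by (rule lipschitz_onD)
    also have "\<dots> \<le> L * (\<epsilon> / L)" using z assms(3) by (intro mult_left_mono) (auto simp: dist_commute)
    finally have "f z \<le> f xstar + \<epsilon>" using assms(3) by (simp add: dist_real_def)
    then show "\<omega> \<in> {\<omega> \<in> space M. eps_successful f X \<epsilon> p (A \<omega>)}"
      using \<omega> zX unfolding eps_successful_def Inf z_def by blast
  qed
  \<comment> \<open>The measurable event \<open>E\<close> competes in the supremum defining
    \<open>inner_prob\<close>, so the success event itself need not be measurable.\<close>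
  then have "measure M E \<le> inner_prob M {\<omega> \<in> space M. eps_successful f X \<epsilon> p (A \<omega>)}"
    unfolding inner_prob_def using E by (intro cSUP_upper bdd_aboveI2[of _ _ 1]) auto
  then show "tau (\<epsilon> / (L * R_max)) CARD('d) CARD('D)
      \<le> inner_prob M {\<omega> \<in> space M. eps_successful f X \<epsilon> p (A \<omega>)}"
    using tau by (simp add: r_def)
qed

end
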